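(* Let $\mathcal{D}$ be a well generated triangulated category, $\omega$ a partial silting object in $\mathcal{D}$, and consider the associated recollement with outer terms $\omega^{\perp_{\mathbb{Z}}}$ and $\mathrm{Loc}(\omega)$ and functors $i^*,i_*,i^!$, $j_!,j^*,j_*$, where $i_*$ and $j_!$ are the inclusions. Assume that $\mathcal{D}$, $\mathrm{Loc}(\omega)$ and $\omega^{\perp_{\mathbb{Z}}}$ satisfy dual Brown representability. Let $\sigma$ be a silting object in $\omega^{\perp_{\mathbb{Z}}}$, and assume that (1) $(i_*\sigma)^{\perp_{>0}}\cap(j_!\omega)^{\perp_{>0}}$ is closed under coproducts in $\mathcal{D}$ and (2) $\mathrm{Hom}_{\mathcal{D}}(i_*\sigma,j_!\omega[k])=0$ for all $k\ge 2$. Let $I=\mathrm{Hom}_{\mathcal{D}}(i_*\sigma,j_!\omega[1])$, let $\tilde\sigma$ be the cocone of the canonical map $\alpha\colon i_*\sigma^{(I)}\to j_!\omega[1]$, and let $\rho=\tilde\sigma\oplus i_*\sigma$ (a silting object of $\mathcal{D}$). Let $(\mathcal{Y}',\mathcal{Y}'')=({}^{\perp_0}(\sigma^{\perp_{\ge 0}}),\sigma^{\perp_{\ge 0}})$ and $(\mathcal{X}',\mathcal{X}'')=({}^{\perp_0}(\omega^{\perp_{\ge 0}}),\omega^{\perp_{\ge 0}})$ be the co-t-structures associated to $\sigma$ in $\omega^{\perp_{\mathbb{Z}}}$ and to $\omega$ in $\mathrm{Loc}(\omega)$, and let $(\mathcal{D}',\mathcal{D}'')$ be the co-t-structure in $\mathcal{D}$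 obtained by gluing them along the recollement, that is $$\mathcal{D}'=\{Z\in\mathcal{D} : i^*Z\in\mathcal{Y}',\ j^*Z\in\mathcal{X}'\},\qquad \mathcal{D}''=\{Z\in\mathcal{D} : i^!Z\in\mathcal{Y}'',\ j^*Z\in\mathcal{X}''\}.$$ Then the co-t-structures $({}^{\perp_0}(\rho^{\perp_{\ge 0}}),\rho^{\perp_{\ge 0}})$ and $(\mathcal{D}',\mathcal{D}'')$ in $\mathcal{D}$ coincide.
   Context: Well generated is meant in the sense of Neeman/Krause. A triangulated category satisfies dual Brown representability if it has products and every covariant cohomological functor to abelian groups sending products to products is representable. For a class $\mathcal{C}$ (or an object) of a triangulated category $\mathcal{T}$ and a set $I$ of integers (written $>0$, $\ge 0$, $0$, $\mathbb{Z}$, ...), $\mathcal{C}^{\perp_I}=\{Y\in\mathcal{T} : \mathrm{Hom}(X,Y[i])=0\ \forall X\in\mathcal{C}, i\in I\}$ and ${}^{\perp_I}\mathcal{C}=\{Y\in\mathcal{T} : \mathrm{Hom}(Y,X[i])=0\ \forall X\in\mathcal{C}, i\in I\}$; orthogonals of $\sigma$ are taken in $\omega^{\perp_{\mathbb{Z}}}$, of $\omega$ in $\mathrm{Loc}(\omega)$ and of $\rho$ in $\mathcal{D}$ when defining the co-t-structures. $\mathrm{Loc}(\omega)$ is the smallest triangulated subcategory containing $\omega$ and closed under coproducts. $X^{(J)}$ is the coproduct of $J$ copies of $X$; the canonical map $\alpha$ has component $f$ at $f\in I$. A torsion pair $(\mathcal{U},\mathcal{V})$ is a pair of full subcategories closed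 under summands with $\mathrm{Hom}(\mathcal{U},\mathcal{V})=0$ such that every object $X$ lies in a triangle $U\to X\to V\to U[1]$ with $U\in\mathcal{U}$, $V\in\mathcal{V}$; it is a t-structure (resp. co-t-structure) if $\mathcal{U}$ (resp. $\mathcal{V}$) is closed under positive shifts and extensions. An object $\sigma$ is silting if $(\sigma^{\perp_{>0}},\sigma^{\perp_{\le 0}})$ is a t-structure. In a well generated category, $\omega$ is partial silting if $\omega\in\omega^{\perp_{>0}}$ and $\omega^{\perp_{>0}}$ is closed under coproducts. For $\omega$ partial silting there is a recollement $\omega^{\perp_{\mathbb{Z}}} \xrightarrow{i_*} \mathcal{D} \xrightarrow{j^*} \mathrm{Loc}(\omega)$ with $i_*$ and $j_!\colon\mathrm{Loc}(\omega)\to\mathcal{D}$ the inclusions, adjoint pairs $(i^*,i_* ),(i_*,i^!),(j_!,j^* ),(j^*,j_* )$, with $i_*,j_!,j_*$ fully faithful and $i^!j_*=0$; $\omega$ is silting in $\mathrm{Loc}(\omega)$. In a well generated triangulated category satisfying dual Brown representability, every silting object $T$ gives a co-t-structure $({}^{\perp_0}(T^{\perp_{>0}}),T^{\perp_{>0}})$ (and hence, by shifting, $({}^{\perp_0}(T^{\perp_{\ge0}}),T^{\perp_{\ge 0}})$). *)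

theory Defs
  imports "HOL-Algebra.Coset"
begin

unbundle cardinal_syntax

section \<open>Smallness\<close>

text \<open>
  The set-theoretic background (sets versus classes) is a Grothendieck universe: a set \<open>U\<close> whose
  cardinality is strongly inaccessible. The objects and the morphisms of a category may form
  arbitrary HOL sets; the set-indexed families, morphism sets and abelian groups of the
  literature are those of size less than \<open>U\<close>. Up to bijection, every small set is a subset of \<open>U\<close>.
\<close>

definition universe :: "'u set \<Rightarrow> bool" where
  "universe U \<longleftrightarrow> natLeq <o |U| \<and> regularCard |U| \<and>
     (\<forall>A :: 'u set. |A| <o |U| \<longrightarrow> |Pow A| <o |U| )"

definition small :: "'u set \<Rightarrow> 'a set \<Rightarrow> bool" where
  "small U A \<longleftrightarrow> |A| <o |U|"

section \<open>Triangulated categories\<close>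

text \<open>
  Following Neeman, the suspension is an automorphism of the category: \<open>Sob\<close> on objects and
  \<open>Sar\<close> on morphisms. An element \<open>(u, v, w)\<close> of \<open>Tri\<close> is a distinguished triangle
  \<open>X \<rightarrow> Y \<rightarrow> Z \<rightarrow> X[1]\<close>. The composite "\<open>g\<close> after \<open>f\<close>" is \<open>g \<cdot> f\<close>.
\<close>

record ('o, 'm) tricat =
  Obj :: "'o set"
  Arr :: "'m set"
  Dom :: "'m \<Rightarrow> 'o"
  Cod :: "'m \<Rightarrow> 'o"
  Ident :: "'o \<Rightarrow> 'm"
  Comp :: "'m \<Rightarrow> 'm \<Rightarrow> 'm" (infixl \<open>\<cdot>\<index>\<close> 70)
  Zero :: "'o \<Rightarrow> 'o \<Rightarrow> 'm"
  Add :: "'m \<Rightarrow> 'm \<Rightarrow> 'm"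
  Sob :: "'o \<Rightarrow> 'o"
  Sar :: "'m \<Rightarrow> 'm"
  Tri :: "('m \<times> 'm \<times> 'm) set"

definition Hom :: "('o, 'm) tricat \<Rightarrow> 'o \<Rightarrow> 'o \<Rightarrow> 'm set" where
  "Hom C X Y = {f \<in> Arr C. Dom C f = X \<and> Cod C f = Y}"

definition hom_group :: "('o, 'm) tricat \<Rightarrow> 'o \<Rightarrow> 'o \<Rightarrow> 'm monoid" where
  "hom_group C X Y = \<lparr>carrier = Hom C X Y, mult = Add C, one = Zero C X Y\<rparr>"

definition Neg :: "('o, 'm) tricat \<Rightarrow> 'm \<Rightarrow> 'm" where
  "Neg C f = inv\<^bsub>hom_group C (Dom C f) (Cod C f)\<^esub> f"

definition is_zero :: "('o, 'm) tricat \<Rightarrow> 'o \<Rightarrow> bool" where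
  "is_zero C X \<longleftrightarrow> X \<in> Obj C \<and> Ident C X = Zero C X X"

definition is_iso_arr :: "('o, 'm) tricat \<Rightarrow> 'm \<Rightarrow> bool" where
  "is_iso_arr C f \<longleftrightarrow> f \<in> Arr C \<and> (\<exists>g \<in> Hom C (Cod C f) (Dom C f).
     Comp C g f = Ident C (Dom C f) \<and> Comp C f g = Ident C (Cod C f))"

definition direct_sum :: "('o, 'm) tricat \<Rightarrow> 'o \<Rightarrow> 'o \<Rightarrow> 'o \<Rightarrow> bool" where
  "direct_sum C X Y Z \<longleftrightarrow> X \<in> Obj C \<and> Y \<in> Obj C \<and> Z \<in> Obj C \<and>
     (\<exists>i \<in> Hom C X Z. \<exists>j \<in> Hom C Y Z. \<exists>p \<in> Hom C Z X. \<exists>q \<in> Hom C Z Y.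
        Comp C p i = Ident C X \<and> Comp C q j = Ident C Y \<and>
        Comp C q i = Zero C X Y \<and> Comp C p j = Zero C Y X \<and>
        Add C (Comp C i p) (Comp C j q) = Ident C Z)"

locale cat =
  fixes C :: "('o, 'm) tricat" (structure)
  assumes Dom_Cod: "f \<in> Arr C \<Longrightarrow> Dom C f \<in> Obj C \<and> Cod C f \<in> Obj C"
    and Ident_Hom: "X \<in> Obj C \<Longrightarrow> Ident C X \<in> Hom C X X"
    and Comp_Hom: "f \<in> Hom C X Y \<Longrightarrow> g \<in> Hom C Y Z \<Longrightarrow> g \<cdot> f \<in> Hom C X Z"
    and Comp_assoc: "f \<in> Hom C W X \<Longrightarrow> g \<in> Hom C X Y \<Longrightarrow> h \<in> Hom C Y Z \<Longrightarrow>
      (h \<cdot> g) \<cdot> f = h \<cdot> (g \<cdot> f)"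
    and Ident_left: "f \<in> Hom C X Y \<Longrightarrow> Ident C Y \<cdot> f = f"
    and Ident_right: "f \<in> Hom C X Y \<Longrightarrow> f \<cdot> Ident C X = f"

locale additive_cat = cat +
  assumes Hom_group: "X \<in> Obj C \<Longrightarrow> Y \<in> Obj C \<Longrightarrow> comm_group (hom_group C X Y)"
    and Comp_Add: "f \<in> Hom C X Y \<Longrightarrow> g \<in> Hom C Y Z \<Longrightarrow> g' \<in> Hom C Y Z \<Longrightarrow>
      Add C g g' \<cdot> f = Add C (g \<cdot> f) (g' \<cdot> f)"
    and Add_Comp: "f \<in> Hom C X Y \<Longrightarrow> f' \<in> Hom C X Y \<Longrightarrow> g \<in> Hom C Y Z \<Longrightarrow>
      g \<cdot> Add C f f' = Add C (g \<cdot> f) (g \<cdot> f')"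
    and zero_ex: "\<exists>X. is_zero C X"
    and direct_sum_ex: "X \<in> Obj C \<Longrightarrow> Y \<in> Obj C \<Longrightarrow> \<exists>Z. direct_sum C X Y Z"

locale suspended_cat = additive_cat +
  assumes Sob_bij: "bij_betw (Sob C) (Obj C) (Obj C)"
    and Sar_bij: "X \<in> Obj C \<Longrightarrow> Y \<in> Obj C \<Longrightarrow>
      bij_betw (Sar C) (Hom C X Y) (Hom C (Sob C X) (Sob C Y))"
    and Sar_Ident: "X \<in> Obj C \<Longrightarrow> Sar C (Ident C X) = Ident C (Sob C X)"
    and Sar_Comp: "f \<in> Hom C X Y \<Longrightarrow> g \<in> Hom C Y Z \<Longrightarrow> Sar C (g \<cdot> f) = Sar C g \<cdot> Sar C f"
    and Sar_Add: "f \<in> Hom C X Y \<Longrightarrow> f' \<in> Hom C X Y \<Longrightarrow>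
      Sar C (Add C f f') = Add C (Sar C f) (Sar C f')"

definition candidate :: "('o, 'm) tricat \<Rightarrow> 'm \<Rightarrow> 'm \<Rightarrow> 'm \<Rightarrow> bool" where
  "candidate C u v w \<longleftrightarrow> u \<in> Arr C \<and> v \<in> Arr C \<and> w \<in> Arr C \<and>
     Cod C u = Dom C v \<and> Cod C v = Dom C w \<and> Cod C w = Sob C (Dom C u)"

locale triangulated_cat = suspended_cat +
  assumes Tri_candidate: "(u, v, w) \<in> Tri C \<Longrightarrow> candidate C u v w"
    and Tri_iso: "(u, v, w) \<in> Tri C \<Longrightarrow> candidate C u' v' w' \<Longrightarrow>
      is_iso_arr C f \<Longrightarrow> is_iso_arr C g \<Longrightarrow> is_iso_arr C h \<Longrightarrow>
      f \<in> Hom C (Dom C u) (Dom C u') \<Longrightarrow> g \<in> Hom C (Dom C v) (Dom C v') \<Longrightarrow>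
      h \<in> Hom C (Dom C w) (Dom C w') \<Longrightarrow>
      u' \<cdot> f = g \<cdot> u \<Longrightarrow> v' \<cdot> g = h \<cdot> v \<Longrightarrow> w' \<cdot> h = Sar C f \<cdot> w \<Longrightarrow> (u', v', w') \<in> Tri C"
    and Tri_Ident: "X \<in> Obj C \<Longrightarrow> is_zero C Z \<Longrightarrow>
      (Ident C X, Zero C X Z, Zero C Z (Sob C X)) \<in> Tri C"
    and Tri_ex: "u \<in> Arr C \<Longrightarrow> \<exists>v w. (u, v, w) \<in> Tri C"
    and Tri_rotate: "candidate C u v w \<Longrightarrow>
      (u, v, w) \<in> Tri C \<longleftrightarrow> (v, w, Neg C (Sar C u)) \<in> Tri C"
    and Tri_morphism: "(u, v, w) \<in> Tri C \<Longrightarrow> (u', v', w') \<in> Tri C \<Longrightarrow>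
      f \<in> Hom C (Dom C u) (Dom C u') \<Longrightarrow> g \<in> Hom C (Dom C v) (Dom C v') \<Longrightarrow> u' \<cdot> f = g \<cdot> u \<Longrightarrow>
      \<exists>h \<in> Hom C (Dom C w) (Dom C w'). v' \<cdot> g = h \<cdot> v \<and> w' \<cdot> h = Sar C f \<cdot> w"
    and octahedral: "(u, i, i') \<in> Tri C \<Longrightarrow> (v, j, j') \<in> Tri C \<Longrightarrow> Cod C u = Dom C v \<Longrightarrow>
      (v \<cdot> u, k, k') \<in> Tri C \<Longrightarrow>
      \<exists>f g. (f, g, Sar C i \<cdot> j') \<in> Tri C \<and>
        Dom C f = Cod C i \<and> Cod C f = Cod C k \<and> Cod C g = Cod C j \<and>
        f \<cdot> i = k \<cdot> v \<and> k' \<cdot> f = i' \<and> g \<cdot> k = j \<and> j' \<cdot> g = Sar C u \<cdot> k'"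

text \<open>\<open>shift C n X\<close> is \<open>X[n]\<close> for an arbitrary integer \<open>n\<close>.\<close>

definition shift :: "('o, 'm) tricat \<Rightarrow> int \<Rightarrow> 'o \<Rightarrow> 'o" where
  "shift C n X = (if 0 \<le> n then (Sob C ^^ nat n) X
     else (inv_into (Obj C) (Sob C) ^^ nat (- n)) X)"

text \<open>The full subcategory on \<open>S\<close>; it is used for \<open>S\<close> closed under isomorphism and \<open>[\<plusminus>1]\<close>.\<close>

definition full_sub :: "('o, 'm) tricat \<Rightarrow> 'o set \<Rightarrow> ('o, 'm) tricat" where
  "full_sub C S = C\<lparr>Obj := Obj C \<inter> S,
     Arr := {f \<in> Arr C. Dom C f \<in> S \<and> Cod C f \<in> S},
     Tri := {(u, v, w) \<in> Tri C. Dom C u \<in> S \<and> Dom C v \<in> S \<and> Dom C w \<in> S}\<rparr>"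

section \<open>Coproducts and products\<close>

definition is_coproduct ::
  "('o, 'm) tricat \<Rightarrow> 'i set \<Rightarrow> ('i \<Rightarrow> 'o) \<Rightarrow> 'o \<Rightarrow> ('i \<Rightarrow> 'm) \<Rightarrow> bool" where
  "is_coproduct C J F X \<iota> \<longleftrightarrow> X \<in> Obj C \<and> (\<forall>j \<in> J. \<iota> j \<in> Hom C (F j) X) \<and>
     (\<forall>Y \<in> Obj C. \<forall>f. (\<forall>j \<in> J. f j \<in> Hom C (F j) Y) \<longrightarrow>
        (\<exists>!g. g \<in> Hom C X Y \<and> (\<forall>j \<in> J. Comp C g (\<iota> j) = f j)))"

definition is_product ::
  "('o, 'm) tricat \<Rightarrow> 'i set \<Rightarrow> ('i \<Rightarrow> 'o) \<Rightarrow> 'o \<Rightarrow> ('i \<Rightarrow> 'm) \<Rightarrow> bool" where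
  "is_product C J F X \<pi> \<longleftrightarrow> X \<in> Obj C \<and> (\<forall>j \<in> J. \<pi> j \<in> Hom C X (F j)) \<and>
     (\<forall>Y \<in> Obj C. \<forall>f. (\<forall>j \<in> J. f j \<in> Hom C Y (F j)) \<longrightarrow>
        (\<exists>!g. g \<in> Hom C Y X \<and> (\<forall>j \<in> J. Comp C (\<pi> j) g = f j)))"

definition has_coproducts :: "'u set \<Rightarrow> ('o, 'm) tricat \<Rightarrow> bool" where
  "has_coproducts U C \<longleftrightarrow> (\<forall>(J :: 'u set) F. small U J \<longrightarrow> F ` J \<subseteq> Obj C \<longrightarrow>
     (\<exists>X \<iota>. is_coproduct C J F X \<iota>))"

definition has_products :: "'u set \<Rightarrow> ('o, 'm) tricat \<Rightarrow> bool" where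
  "has_products U C \<longleftrightarrow> (\<forall>(J :: 'u set) F. small U J \<longrightarrow> F ` J \<subseteq> Obj C \<longrightarrow>
     (\<exists>X \<pi>. is_product C J F X \<pi>))"

definition coproduct_closed :: "'u set \<Rightarrow> ('o, 'm) tricat \<Rightarrow> 'o set \<Rightarrow> bool" where
  "coproduct_closed U C S \<longleftrightarrow> (\<forall>(J :: 'u set) F X \<iota>. small U J \<longrightarrow> F ` J \<subseteq> S \<longrightarrow>
     is_coproduct C J F X \<iota> \<longrightarrow> X \<in> S)"

section \<open>Well generated categories\<close>

definition locally_small :: "'u set \<Rightarrow> ('o, 'm) tricat \<Rightarrow> bool" where
  "locally_small U C \<longleftrightarrow> (\<forall>X \<in> Obj C. \<forall>Y \<in> Obj C. small U (Hom C X Y))"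

text \<open>\<open>S\<close> is \<open>|A|\<close>-small: every morphism from \<open>S\<close> to a coproduct factors through the subcoproduct
  over fewer than \<open>|A|\<close> indices.\<close>

definition card_small_obj :: "'u set \<Rightarrow> ('o, 'm) tricat \<Rightarrow> 'u set \<Rightarrow> 'o \<Rightarrow> bool" where
  "card_small_obj U C A S \<longleftrightarrow> (\<forall>(J :: 'u set) F X \<iota>. small U J \<longrightarrow> F ` J \<subseteq> Obj C \<longrightarrow>
     is_coproduct C J F X \<iota> \<longrightarrow>
     (\<forall>h \<in> Hom C S X. \<exists>J' X' \<iota>'. J' \<subseteq> J \<and> |J'| <o |A| \<and> is_coproduct C J' F X' \<iota>' \<and>
        (\<exists>k \<in> Hom C X' X. (\<forall>j \<in> J'. Comp C k (\<iota>' j) = \<iota> j) \<and>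
           (\<exists>h' \<in> Hom C S X'. h = Comp C k h'))))"

text \<open>Condition (G2) of Krause: the coproduct \<open>g\<close> of a family \<open>f\<close> of \<open>\<S>\<close>-epimorphisms is an
  \<open>\<S>\<close>-epimorphism.\<close>

definition coproducts_preserve_epis :: "'u set \<Rightarrow> ('o, 'm) tricat \<Rightarrow> 'o set \<Rightarrow> bool" where
  "coproducts_preserve_epis U C \<S> \<longleftrightarrow>
     (\<forall>(J :: 'u set) F G f X \<iota> Y \<kappa>. \<forall>g \<in> Hom C X Y.
        small U J \<longrightarrow> F ` J \<subseteq> Obj C \<longrightarrow> G ` J \<subseteq> Obj C \<longrightarrow> (\<forall>j \<in> J. f j \<in> Hom C (F j) (G j)) \<longrightarrow>
        is_coproduct C J F X \<iota> \<longrightarrow> is_coproduct C J G Y \<kappa> \<longrightarrow>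
        (\<forall>j \<in> J. Comp C g (\<iota> j) = Comp C (\<kappa> j) (f j)) \<longrightarrow>
        (\<forall>S \<in> \<S>. \<forall>j \<in> J. Comp C (f j) ` Hom C S (F j) = Hom C S (G j)) \<longrightarrow>
        (\<forall>S \<in> \<S>. Comp C g ` Hom C S X = Hom C S Y))"

text \<open>Krause's form of Neeman's definition (On Neeman's well generated triangulated categories).\<close>

definition well_generated :: "'u set \<Rightarrow> ('o, 'm) tricat \<Rightarrow> bool" where
  "well_generated U C \<longleftrightarrow> triangulated_cat C \<and> locally_small U C \<and> has_coproducts U C \<and>
     (\<exists>\<S>. \<S> \<subseteq> Obj C \<and> small U \<S> \<and>
        (\<forall>X \<in> Obj C. (\<forall>S \<in> \<S>. Hom C S X = {Zero C S X}) \<longrightarrow> is_zero C X) \<and>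
        coproducts_preserve_epis U C \<S> \<and>
        (\<exists>A. small U A \<and> (\<forall>S \<in> \<S>. card_small_obj U C A S)))"

section \<open>Dual Brown representability\<close>

text \<open>
  A covariant functor to abelian groups is given by \<open>Fo\<close> on objects and \<open>Fa\<close> on morphisms. Its
  values are small abelian groups, written multiplicatively as in HOL-Algebra; up to isomorphism,
  such a group can be realised on elements of the type of \<open>U\<close>.
\<close>

definition cohomological_functor ::
  "'u set \<Rightarrow> ('o, 'm) tricat \<Rightarrow> ('o \<Rightarrow> 'u monoid) \<Rightarrow> ('m \<Rightarrow> 'u \<Rightarrow> 'u) \<Rightarrow> bool" where
  "cohomological_functor U C Fo Fa \<longleftrightarrow>
     (\<forall>X \<in> Obj C. comm_group (Fo X) \<and> small U (carrier (Fo X))) \<and>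
     (\<forall>X \<in> Obj C. \<forall>Y \<in> Obj C. \<forall>f \<in> Hom C X Y. Fa f \<in> hom (Fo X) (Fo Y)) \<and>
     (\<forall>X \<in> Obj C. \<forall>x \<in> carrier (Fo X). Fa (Ident C X) x = x) \<and>
     (\<forall>X \<in> Obj C. \<forall>Y \<in> Obj C. \<forall>Z \<in> Obj C. \<forall>f \<in> Hom C X Y. \<forall>g \<in> Hom C Y Z.
        \<forall>x \<in> carrier (Fo X). Fa (Comp C g f) x = Fa g (Fa f x)) \<and>
     (\<forall>X \<in> Obj C. \<forall>Y \<in> Obj C. \<forall>f \<in> Hom C X Y. \<forall>g \<in> Hom C X Y.
        \<forall>x \<in> carrier (Fo X). Fa (Add C f g) x = Fa f x \<otimes>\<^bsub>Fo Y\<^esub> Fa g x) \<and>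
     (\<forall>(u, v, w) \<in> Tri C.
        Fa u ` carrier (Fo (Dom C u)) = kernel (Fo (Dom C v)) (Fo (Cod C v)) (Fa v))"

definition preserves_products ::
  "'u set \<Rightarrow> ('o, 'm) tricat \<Rightarrow> ('o \<Rightarrow> 'u monoid) \<Rightarrow> ('m \<Rightarrow> 'u \<Rightarrow> 'u) \<Rightarrow> bool" where
  "preserves_products U C Fo Fa \<longleftrightarrow> (\<forall>(J :: 'u set) F X \<pi>. small U J \<longrightarrow> F ` J \<subseteq> Obj C \<longrightarrow>
     is_product C J F X \<pi> \<longrightarrow>
     (\<forall>x. (\<forall>j \<in> J. x j \<in> carrier (Fo (F j))) \<longrightarrow>
        (\<exists>!y. y \<in> carrier (Fo X) \<and> (\<forall>j \<in> J. Fa (\<pi> j) y = x j))))"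

definition representable ::
  "('o, 'm) tricat \<Rightarrow> ('o \<Rightarrow> 'u monoid) \<Rightarrow> ('m \<Rightarrow> 'u \<Rightarrow> 'u) \<Rightarrow> bool" where
  "representable C Fo Fa \<longleftrightarrow> (\<exists>A \<in> Obj C. \<exists>\<eta>.
     (\<forall>X \<in> Obj C. \<eta> X \<in> iso (hom_group C A X) (Fo X)) \<and>
     (\<forall>X \<in> Obj C. \<forall>Y \<in> Obj C. \<forall>f \<in> Hom C X Y. \<forall>h \<in> Hom C A X.
        \<eta> Y (Comp C f h) = Fa f (\<eta> X h)))"

definition dual_Brown :: "'u set \<Rightarrow> ('o, 'm) tricat \<Rightarrow> bool" where
  "dual_Brown U C \<longleftrightarrow> has_products U C \<and>
     (\<forall>(Fo :: 'o \<Rightarrow> 'u monoid) Fa.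
        cohomological_functor U C Fo Fa \<longrightarrow> preserves_products U C Fo Fa \<longrightarrow> representable C Fo Fa)"

section \<open>Orthogonals, torsion pairs and silting objects\<close>

definition rperp :: "('o, 'm) tricat \<Rightarrow> 'o set \<Rightarrow> int set \<Rightarrow> 'o set" where
  "rperp C \<C> I = {Y \<in> Obj C. \<forall>X \<in> \<C>. \<forall>i \<in> I. Hom C X (shift C i Y) = {Zero C X (shift C i Y)}}"

definition lperp :: "('o, 'm) tricat \<Rightarrow> 'o set \<Rightarrow> int set \<Rightarrow> 'o set" where
  "lperp C \<C> I = {Y \<in> Obj C. \<forall>X \<in> \<C>. \<forall>i \<in> I. Hom C Y (shift C i X) = {Zero C Y (shift C i X)}}"

definition summand_closed :: "('o, 'm) tricat \<Rightarrow> 'o set \<Rightarrow> bool" where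
  "summand_closed C S \<longleftrightarrow> (\<forall>X Y Z. direct_sum C X Y Z \<longrightarrow> Z \<in> S \<longrightarrow> X \<in> S)"

definition extension_closed :: "('o, 'm) tricat \<Rightarrow> 'o set \<Rightarrow> bool" where
  "extension_closed C S \<longleftrightarrow>
     (\<forall>(u, v, w) \<in> Tri C. Dom C u \<in> S \<longrightarrow> Cod C v \<in> S \<longrightarrow> Cod C u \<in> S)"

definition torsion_pair :: "('o, 'm) tricat \<Rightarrow> 'o set \<Rightarrow> 'o set \<Rightarrow> bool" where
  "torsion_pair C \<U> \<V> \<longleftrightarrow> \<U> \<subseteq> Obj C \<and> \<V> \<subseteq> Obj C \<and> summand_closed C \<U> \<and> summand_closed C \<V> \<and>
     (\<forall>X \<in> \<U>. \<forall>Y \<in> \<V>. Hom C X Y = {Zero C X Y}) \<and>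
     (\<forall>X \<in> Obj C. \<exists>(u, v, w) \<in> Tri C. Dom C u \<in> \<U> \<and> Cod C u = X \<and> Cod C v \<in> \<V>)"

definition t_structure :: "('o, 'm) tricat \<Rightarrow> 'o set \<Rightarrow> 'o set \<Rightarrow> bool" where
  "t_structure C \<U> \<V> \<longleftrightarrow> torsion_pair C \<U> \<V> \<and> Sob C ` \<U> \<subseteq> \<U> \<and> extension_closed C \<U>"

definition silting :: "('o, 'm) tricat \<Rightarrow> 'o \<Rightarrow> bool" where
  "silting C T \<longleftrightarrow> T \<in> Obj C \<and> t_structure C (rperp C {T} {0<..}) (rperp C {T} {..0})"

definition partial_silting :: "'u set \<Rightarrow> ('o, 'm) tricat \<Rightarrow> 'o \<Rightarrow> bool" where
  "partial_silting U C T \<longleftrightarrow> T \<in> rperp C {T} {0<..} \<and> coproduct_closed U C (rperp C {T} {0<..})"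

text \<open>For silting \<open>T\<close>, the co-t-structure associated to \<open>T\<close>, as a pair of classes of objects.\<close>

definition silting_cotstr :: "('o, 'm) tricat \<Rightarrow> 'o \<Rightarrow> 'o set \<times> 'o set" where
  "silting_cotstr C T = (lperp C (rperp C {T} {0..}) {0}, rperp C {T} {0..})"

definition triangulated_sub :: "('o, 'm) tricat \<Rightarrow> 'o set \<Rightarrow> bool" where
  "triangulated_sub C S \<longleftrightarrow> S \<subseteq> Obj C \<and> {X. is_zero C X} \<subseteq> S \<and>
     (\<forall>f. is_iso_arr C f \<longrightarrow> Dom C f \<in> S \<longrightarrow> Cod C f \<in> S) \<and>
     (\<forall>X \<in> Obj C. Sob C X \<in> S \<longleftrightarrow> X \<in> S) \<and>
     (\<forall>(u, v, w) \<in> Tri C. Dom C u \<in> S \<longrightarrow> Cod C u \<in> S \<longrightarrow> Cod C v \<in> S)"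

definition Loc :: "'u set \<Rightarrow> ('o, 'm) tricat \<Rightarrow> 'o \<Rightarrow> 'o set" where
  "Loc U C T = \<Inter>{S. triangulated_sub C S \<and> coproduct_closed U C S \<and> T \<in> S}"

section \<open>Functors and recollements\<close>

record ('o, 'm, 'p, 'n) fctr =
  fob :: "'o \<Rightarrow> 'p"
  far :: "'m \<Rightarrow> 'n"

definition is_fctr ::
  "('o, 'm) tricat \<Rightarrow> ('p, 'n) tricat \<Rightarrow> ('o, 'm, 'p, 'n) fctr \<Rightarrow> bool" where
  "is_fctr C D F \<longleftrightarrow> (\<forall>X \<in> Obj C. fob F X \<in> Obj D) \<and>
     (\<forall>X \<in> Obj C. \<forall>Y \<in> Obj C. \<forall>f \<in> Hom C X Y. far F f \<in> Hom D (fob F X) (fob F Y)) \<and>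
     (\<forall>X \<in> Obj C. far F (Ident C X) = Ident D (fob F X)) \<and>
     (\<forall>X \<in> Obj C. \<forall>Y \<in> Obj C. \<forall>Z \<in> Obj C. \<forall>f \<in> Hom C X Y. \<forall>g \<in> Hom C Y Z.
        far F (Comp C g f) = Comp D (far F g) (far F f))"

definition triangle_fctr ::
  "('o, 'm) tricat \<Rightarrow> ('p, 'n) tricat \<Rightarrow> ('o, 'm, 'p, 'n) fctr \<Rightarrow> bool" where
  "triangle_fctr C D F \<longleftrightarrow> is_fctr C D F \<and>
     (\<forall>X \<in> Obj C. \<forall>Y \<in> Obj C. \<forall>f \<in> Hom C X Y. \<forall>g \<in> Hom C X Y.
        far F (Add C f g) = Add D (far F f) (far F g)) \<and>
     (\<exists>\<theta>. (\<forall>X \<in> Obj C. is_iso_arr D (\<theta> X) \<and>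
             \<theta> X \<in> Hom D (fob F (Sob C X)) (Sob D (fob F X))) \<and>
        (\<forall>X \<in> Obj C. \<forall>Y \<in> Obj C. \<forall>f \<in> Hom C X Y.
             Comp D (\<theta> Y) (far F (Sar C f)) = Comp D (Sar D (far F f)) (\<theta> X)) \<and>
        (\<forall>(u, v, w) \<in> Tri C. (far F u, far F v, Comp D (\<theta> (Dom C u)) (far F w)) \<in> Tri D))"

definition fully_faithful ::
  "('o, 'm) tricat \<Rightarrow> ('p, 'n) tricat \<Rightarrow> ('o, 'm, 'p, 'n) fctr \<Rightarrow> bool" where
  "fully_faithful C D F \<longleftrightarrow> (\<forall>X \<in> Obj C. \<forall>Y \<in> Obj C.
     bij_betw (far F) (Hom C X Y) (Hom D (fob F X) (fob F Y)))"

text \<open>\<open>L : C \<rightarrow> D\<close> is left adjoint to \<open>R : D \<rightarrow> C\<close>.\<close>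

definition adjoint_pair :: "('o, 'm) tricat \<Rightarrow> ('p, 'n) tricat \<Rightarrow>
  ('o, 'm, 'p, 'n) fctr \<Rightarrow> ('p, 'n, 'o, 'm) fctr \<Rightarrow> bool" where
  "adjoint_pair C D L R \<longleftrightarrow> (\<exists>\<phi>.
     (\<forall>X \<in> Obj C. \<forall>Y \<in> Obj D. bij_betw (\<phi> X Y) (Hom D (fob L X) Y) (Hom C X (fob R Y))) \<and>
     (\<forall>X \<in> Obj C. \<forall>X' \<in> Obj C. \<forall>Y \<in> Obj D. \<forall>Y' \<in> Obj D.
        \<forall>f \<in> Hom C X' X. \<forall>g \<in> Hom D Y Y'. \<forall>h \<in> Hom D (fob L X) Y.
          \<phi> X' Y' (Comp D g (Comp D h (far L f))) = Comp C (far R g) (Comp C (\<phi> X Y h) f)))"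

definition is_inclusion :: "('o, 'm) tricat \<Rightarrow> ('o, 'm, 'o, 'm) fctr \<Rightarrow> bool" where
  "is_inclusion S F \<longleftrightarrow> (\<forall>X \<in> Obj S. fob F X = X) \<and> (\<forall>f \<in> Arr S. far F f = f)"

text \<open>
  The six functors are listed in the order \<open>i\<^sup>*, i\<^sub>*, i\<^sup>!, j\<^sub>!, j\<^sup>*, j\<^sub>*\<close>. When \<open>i\<^sub>*\<close> and \<open>j\<^sub>!\<close> are the
  inclusions of \<open>\<omega>\<^sup>\<bottom>\<close> (orthogonal in all degrees) and of the localizing subcategory generated
  by \<open>\<omega>\<close>, as below, the gluing triangles exist automatically and need not be postulated.
\<close>

definition recollement ::
  "('p, 'n) tricat \<Rightarrow> ('o, 'm) tricat \<Rightarrow> ('q, 'l) tricat \<Rightarrow>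
   ('o, 'm, 'p, 'n) fctr \<Rightarrow> ('p, 'n, 'o, 'm) fctr \<Rightarrow> ('o, 'm, 'p, 'n) fctr \<Rightarrow>
   ('q, 'l, 'o, 'm) fctr \<Rightarrow> ('o, 'm, 'q, 'l) fctr \<Rightarrow> ('q, 'l, 'o, 'm) fctr \<Rightarrow> bool" where
  "recollement Y D X iup ilow ishriek jshriek jup jlow \<longleftrightarrow>
     triangle_fctr D Y iup \<and> triangle_fctr Y D ilow \<and> triangle_fctr D Y ishriek \<and>
     triangle_fctr X D jshriek \<and> triangle_fctr D X jup \<and> triangle_fctr X D jlow \<and>
     adjoint_pair D Y iup ilow \<and> adjoint_pair Y D ilow ishriek \<and>
     adjoint_pair X D jshriek jup \<and> adjoint_pair D X jup jlow \<and>
     fully_faithful Y D ilow \<and> fully_faithful X D jshriek \<and> fully_faithful X D jlow \<and>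
     (\<forall>A \<in> Obj X. is_zero Y (fob ishriek (fob jlow A)))"

text \<open>\<open>K\<close> is a cocone of \<open>\<alpha>\<close>: there is a triangle \<open>K \<rightarrow> dom \<alpha> \<rightarrow> cod \<alpha> \<rightarrow> K[1]\<close>.\<close>

definition is_cocone :: "('o, 'm) tricat \<Rightarrow> 'm \<Rightarrow> 'o \<Rightarrow> bool" where
  "is_cocone C \<alpha> K \<longleftrightarrow> (\<exists>u w. (u, \<alpha>, w) \<in> Tri C \<and> Dom C u = K)"

definition glued ::
  "('o, 'm) tricat \<Rightarrow> ('o, 'm, 'p, 'n) fctr \<Rightarrow> ('o, 'm, 'p, 'n) fctr \<Rightarrow> ('o, 'm, 'q, 'l) fctr \<Rightarrow>
   'p set \<times> 'p set \<Rightarrow> 'q set \<times> 'q set \<Rightarrow> 'o set \<times> 'o set" where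
  "glued D iup ishriek jup \<Y> \<X> =
     ({Z \<in> Obj D. fob iup Z \<in> fst \<Y> \<and> fob jup Z \<in> fst \<X>},
      {Z \<in> Obj D. fob ishriek Z \<in> snd \<Y> \<and> fob jup Z \<in> snd \<X>})"

end

theory Submission
  imports Defs
begin

text \<open>
  Everything reduces to the description of both coaisles as one class: \<open>\<rho>\<^sup>\<bottom>\<close> and \<open>D''\<close> are each
  equal to \<open>\<sigma>\<^sup>\<bottom> \<inter> \<omega>\<^sup>\<bottom>\<close>, orthogonals being taken in \<open>D\<close> and in all degrees \<open>\<ge> 0\<close>.

  For \<open>\<rho>\<close>, rotate the triangle defining the cocone to \<open>\<omega> \<rightarrow> \<sigma>~ \<rightarrow> \<sigma>\<^sup>(\<^sup>I\<^sup>) \<rightarrow> \<omega>[1]\<close>. If \<open>Z\<close> lies in \<open>\<sigma>\<^sup>\<bottom>\<close>,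
  then \<open>\<sigma>\<^sup>(\<^sup>I\<^sup>)\<close> has no morphisms to \<open>Z[n]\<close> and \<open>Z[n+1]\<close> for \<open>n \<ge> 0\<close>, so that
  \<open>Hom(\<sigma>~, Z[n]) \<cong> Hom(\<omega>, Z[n])\<close>; this is \<open>rperp_cocone_direct_sum\<close>. For \<open>D''\<close>, use the
  adjunctions \<open>Hom(\<sigma>, i\<^sup>! Z[n]) \<cong> Hom(i\<^sub>* \<sigma>, Z[n])\<close> and \<open>Hom(\<omega>, j\<^sup>* Z[n]) \<cong> Hom(j\<^sub>! \<omega>, Z[n])\<close>; this is
  \<open>rperp_coreflection_iff\<close>.

  It remains to see that \<open>D'\<close> is the left orthogonal of \<open>D''\<close>. If \<open>Z\<close> lies in \<open>D'\<close> and \<open>W\<close> in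
  \<open>D''\<close>, a morphism \<open>Z \<rightarrow> W\<close> vanishes on \<open>j\<^sub>! j\<^sup>* Z \<rightarrow> Z\<close> because \<open>Hom(j\<^sup>* Z, j\<^sup>* W) = 0\<close>, so it factors
  through the cone of that counit. The cone lies in the image of \<open>i\<^sub>*\<close>
  (\<open>coreflection_triangle\<close>), so the morphism factors further through \<open>i\<^sub>* i\<^sup>! W \<rightarrow> W\<close>, and it
  vanishes because \<open>Hom(Z, i\<^sub>* i\<^sup>! W) \<cong> Hom(i\<^sup>* Z, i\<^sup>! W) = 0\<close>; this is \<open>orth_glued\<close>. Conversely, let
  \<open>Z\<close> be left orthogonal to \<open>D''\<close>. Both \<open>i\<^sub>* B\<close> for \<open>B\<close> in \<open>Y''\<close> and \<open>j\<^sub>* B\<close> for \<open>B\<close> in \<open>X''\<close> belong to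
  \<open>D''\<close>, and the adjunctions turn \<open>Hom(Z, i\<^sub>* B) = 0\<close> and \<open>Hom(Z, j\<^sub>* B) = 0\<close> into the defining
  conditions of \<open>D'\<close>.
\<close>


section \<open>Hom sets, full subcategories and adjunctions\<close>

text \<open>Orthogonality of two objects, in the form in which it occurs in the orthogonal classes.\<close>

abbreviation (input) orth :: "('o, 'm) tricat \<Rightarrow> 'o \<Rightarrow> 'o \<Rightarrow> bool" where
  "orth C A B \<equiv> Hom C A B = {Zero C A B}"

lemma orthI:
  assumes "Zero C A B \<in> Hom C A B" "\<And>f g. f \<in> Hom C A B \<Longrightarrow> g \<in> Hom C A B \<Longrightarrow> f = g"
  shows "orth C A B"
proof (intro equalityI subsetI)
  fix f assume "f \<in> Hom C A B"
  from assms(2)[OF this assms(1)] show "f \<in> {Zero C A B}" by simp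
qed (use assms(1) in simp)

lemma orthD: "orth C A B \<Longrightarrow> f \<in> Hom C A B \<Longrightarrow> g \<in> Hom C A B \<Longrightarrow> f = g"
  by simp

lemma bij_betw_orth:
  assumes "bij_betw \<phi> (Hom C A B) (Hom C' A' B')"
    and "Zero C A B \<in> Hom C A B" "Zero C' A' B' \<in> Hom C' A' B'"
  shows "orth C A B \<longleftrightarrow> orth C' A' B'"
proof
  assume "orth C A B"
  then have "Hom C' A' B' = {\<phi> (Zero C A B)}"
    using assms(1) by (metis bij_betw_imp_surj_on image_empty image_insert)
  then show "orth C' A' B'" using assms(3) by simp
next
  assume *: "orth C' A' B'"
  show "orth C A B"
  proof (rule orthI[OF assms(2)])
    fix f g assume "f \<in> Hom C A B" "g \<in> Hom C A B"
    then show "f = g"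
      using * assms(1) by (metis bij_betw_def inj_onD imageI singletonD)
  qed
qed

lemma full_sub_simps [simp]:
  "Obj (full_sub C S) = Obj C \<inter> S" "Dom (full_sub C S) = Dom C" "Cod (full_sub C S) = Cod C"
  "Ident (full_sub C S) = Ident C" "Comp (full_sub C S) = Comp C" "Zero (full_sub C S) = Zero C"
  "Add (full_sub C S) = Add C" "Sob (full_sub C S) = Sob C" "Sar (full_sub C S) = Sar C"
  by (simp_all add: full_sub_def)

lemma Hom_full_sub: "A \<in> S \<Longrightarrow> B \<in> S \<Longrightarrow> Hom (full_sub C S) A B = Hom C A B"
  by (auto simp: Hom_def full_sub_def)

lemma Hom_full_sub_subset: "Hom (full_sub C S) A B \<subseteq> Hom C A B"
  by (auto simp: Hom_def full_sub_def)

lemma Hom_Arr: "f \<in> Hom C A B \<Longrightarrow> f \<in> Arr C"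
  by (simp add: Hom_def)

lemma shift_full_sub_nonneg: "0 \<le> n \<Longrightarrow> shift (full_sub C S) n A = shift C n A"
  by (simp add: shift_def)

lemma cat_full_sub:
  assumes "cat C"
  shows "cat (full_sub C S)"
proof -
  interpret cat C by fact
  have sub: "f \<in> Hom C A B \<and> A \<in> S \<and> B \<in> S" if "f \<in> Hom (full_sub C S) A B" for f A B
    using that by (auto simp: Hom_def full_sub_def)
  show ?thesis
  proof
    show "Dom (full_sub C S) f \<in> Obj (full_sub C S) \<and> Cod (full_sub C S) f \<in> Obj (full_sub C S)"
      if "f \<in> Arr (full_sub C S)" for f
      using that Dom_Cod by (auto simp: full_sub_def)
    show "Ident (full_sub C S) A \<in> Hom (full_sub C S) A A" if "A \<in> Obj (full_sub C S)" for A
      using that Ident_Hom by (simp add: Hom_full_sub)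
    show "Comp (full_sub C S) g f \<in> Hom (full_sub C S) A E"
      if "f \<in> Hom (full_sub C S) A B" "g \<in> Hom (full_sub C S) B E" for f g A B E
      using sub[OF that(1)] sub[OF that(2)] Comp_Hom[of f A B g E]
      by (simp add: Hom_full_sub)
    show "Comp (full_sub C S) (Comp (full_sub C S) h g) f
        = Comp (full_sub C S) h (Comp (full_sub C S) g f)"
      if "f \<in> Hom (full_sub C S) A B" "g \<in> Hom (full_sub C S) B E" "h \<in> Hom (full_sub C S) E F"
      for f g h A B E F
      using sub[OF that(1)] sub[OF that(2)] sub[OF that(3)] Comp_assoc[of f A B g E h F] by simp
    show "Comp (full_sub C S) (Ident (full_sub C S) B) f = f"
      if "f \<in> Hom (full_sub C S) A B" for f A B
      using sub[OF that] Ident_left[of f A B] by simp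
    show "Comp (full_sub C S) f (Ident (full_sub C S) A) = f"
      if "f \<in> Hom (full_sub C S) A B" for f A B
      using sub[OF that] Ident_right[of f A B] by simp
  qed
qed

lemma adjoint_pair_orth:
  assumes "adjoint_pair C D L R" "A \<in> Obj C" "B \<in> Obj D"
    and "Zero D (fob L A) B \<in> Hom D (fob L A) B" "Zero C A (fob R B) \<in> Hom C A (fob R B)"
  shows "orth D (fob L A) B \<longleftrightarrow> orth C A (fob R B)"
proof -
  obtain \<phi> where "bij_betw \<phi> (Hom D (fob L A) B) (Hom C A (fob R B))"
    using assms(1-3) unfolding adjoint_pair_def by blast
  then show ?thesis using assms(4,5) by (rule bij_betw_orth)
qed

text \<open>The universal property of the counit.\<close>

lemma adjoint_pair_counit:
  assumes "cat C" "cat D" "is_fctr C D L" "is_fctr D C R" "adjoint_pair C D L R" "B \<in> Obj D"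
  obtains \<epsilon> where "\<epsilon> \<in> Hom D (fob L (fob R B)) B"
    and "\<And>A. A \<in> Obj C \<Longrightarrow>
      bij_betw (\<lambda>g. Comp D \<epsilon> (far L g)) (Hom C A (fob R B)) (Hom D (fob L A) B)"
proof -
  interpret C: cat C by fact
  interpret D: cat D by fact
  obtain \<phi> where bij: "\<And>A B. A \<in> Obj C \<Longrightarrow> B \<in> Obj D \<Longrightarrow>
        bij_betw (\<phi> A B) (Hom D (fob L A) B) (Hom C A (fob R B))"
    and nat: "\<And>A A' B B' f g h. A \<in> Obj C \<Longrightarrow> A' \<in> Obj C \<Longrightarrow> B \<in> Obj D \<Longrightarrow> B' \<in> Obj D \<Longrightarrow>
        f \<in> Hom C A' A \<Longrightarrow> g \<in> Hom D B B' \<Longrightarrow> h \<in> Hom D (fob L A) B \<Longrightarrow>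
        \<phi> A' B' (Comp D g (Comp D h (far L f))) = Comp C (far R g) (Comp C (\<phi> A B h) f)"
    using assms(5) unfolding adjoint_pair_def by blast
  have RB: "fob R B \<in> Obj C" and R1: "far R (Ident D B) = Ident C (fob R B)"
    using assms(4,6) by (auto simp: is_fctr_def)
  have "Ident C (fob R B) \<in> \<phi> (fob R B) B ` Hom D (fob L (fob R B)) B"
    using bij[OF RB assms(6)] C.Ident_Hom[OF RB] by (simp add: bij_betw_imp_surj_on)
  then obtain \<epsilon> where \<epsilon>: "\<epsilon> \<in> Hom D (fob L (fob R B)) B" "\<phi> (fob R B) B \<epsilon> = Ident C (fob R B)"
    by (metis imageE)
  have "bij_betw (\<lambda>g. Comp D \<epsilon> (far L g)) (Hom C A (fob R B)) (Hom D (fob L A) B)"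
    if A: "A \<in> Obj C" for A
  proof (rule bij_betw_byWitness[where f' = "\<phi> A B"])
    have L: "far L g \<in> Hom D (fob L A) (fob L (fob R B))" if "g \<in> Hom C A (fob R B)" for g
      using assms(3) A RB that by (auto simp: is_fctr_def)
    have eq: "\<phi> A B (Comp D \<epsilon> (far L g)) = g" if g: "g \<in> Hom C A (fob R B)" for g
    proof -
      have "\<phi> A B (Comp D \<epsilon> (far L g)) = \<phi> A B (Comp D (Ident D B) (Comp D \<epsilon> (far L g)))"
        using D.Ident_left[OF D.Comp_Hom[OF L[OF g] \<epsilon>(1)]] by simp
      also have "\<dots> = Comp C (far R (Ident D B)) (Comp C (\<phi> (fob R B) B \<epsilon>) g)"
        using nat[OF RB A assms(6,6) g D.Ident_Hom[OF assms(6)] \<epsilon>(1)] .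
      also have "\<dots> = g"
        using C.Ident_left[OF g] by (simp add: \<epsilon>(2) R1)
      finally show ?thesis .
    qed
    show "\<forall>g\<in>Hom C A (fob R B). \<phi> A B (Comp D \<epsilon> (far L g)) = g"
      using eq by blast
    have im: "Comp D \<epsilon> (far L g) \<in> Hom D (fob L A) B" if "g \<in> Hom C A (fob R B)" for g
      using D.Comp_Hom[OF L[OF that] \<epsilon>(1)] .
    then show "(\<lambda>g. Comp D \<epsilon> (far L g)) ` Hom C A (fob R B) \<subseteq> Hom D (fob L A) B"
      by blast
    show 2: "\<phi> A B ` Hom D (fob L A) B \<subseteq> Hom C A (fob R B)"
      using bij[OF A assms(6)] by (simp add: bij_betw_imp_surj_on)
    show "\<forall>h\<in>Hom D (fob L A) B. Comp D \<epsilon> (far L (\<phi> A B h)) = h"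
    proof
      fix h assume h: "h \<in> Hom D (fob L A) B"
      then have "\<phi> A B h \<in> Hom C A (fob R B)" using 2 by blast
      then show "Comp D \<epsilon> (far L (\<phi> A B h)) = h"
        using eq im h bij[OF A assms(6)] by (metis bij_betw_def inj_onD)
    qed
  qed
  with \<epsilon>(1) show thesis by (rule that)
qed

text \<open>The counit of a fully faithful right adjoint \<open>R\<close> is a split monomorphism, since the unit at
  \<open>R B\<close> lifts along \<open>R\<close>. (It is even invertible.)\<close>

lemma fully_faithful_right_adjoint_split:
  assumes "cat C" "cat D" "is_fctr C D L" "is_fctr D C R" "adjoint_pair C D L R"
    and "fully_faithful D C R" "B \<in> Obj D"
  obtains e s where "e \<in> Hom D (fob L (fob R B)) B" "s \<in> Hom D B (fob L (fob R B))"
    "Comp D s e = Ident D (fob L (fob R B))"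
proof -
  interpret C: cat C by fact
  interpret D: cat D by fact
  obtain \<phi> where bij: "\<And>A B. A \<in> Obj C \<Longrightarrow> B \<in> Obj D \<Longrightarrow>
        bij_betw (\<phi> A B) (Hom D (fob L A) B) (Hom C A (fob R B))"
    and nat: "\<And>A A' B B' f g h. A \<in> Obj C \<Longrightarrow> A' \<in> Obj C \<Longrightarrow> B \<in> Obj D \<Longrightarrow> B' \<in> Obj D \<Longrightarrow>
        f \<in> Hom C A' A \<Longrightarrow> g \<in> Hom D B B' \<Longrightarrow> h \<in> Hom D (fob L A) B \<Longrightarrow>
        \<phi> A' B' (Comp D g (Comp D h (far L f))) = Comp C (far R g) (Comp C (\<phi> A B h) f)"
    using assms(5) unfolding adjoint_pair_def by blast
  define E where "E = fob L (fob R B)"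
  have RB: "fob R B \<in> Obj C" using assms(4,7) by (auto simp: is_fctr_def)
  have E: "E \<in> Obj D" using assms(3) RB by (auto simp: is_fctr_def E_def)
  have "Ident C (fob R B) \<in> \<phi> (fob R B) B ` Hom D E B"
    using bij[OF RB assms(7)] C.Ident_Hom[OF RB] by (simp add: bij_betw_imp_surj_on E_def)
  then obtain e where e: "e \<in> Hom D E B" "\<phi> (fob R B) B e = Ident C (fob R B)"
    by (metis imageE)
  have "\<phi> (fob R B) E (Ident D E) \<in> Hom C (fob R B) (fob R E)"
    using bij[OF RB E] D.Ident_Hom[OF E] bij_betw_apply by (fastforce simp: E_def)
  then have "\<phi> (fob R B) E (Ident D E) \<in> far R ` Hom D B E"
    using assms(6,7) E by (metis fully_faithful_def bij_betw_imp_surj_on)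
  then obtain s where s: "s \<in> Hom D B E" "far R s = \<phi> (fob R B) E (Ident D E)"
    by (metis imageE)
  have Rs: "far R s \<in> Hom C (fob R B) (fob R E)"
    using assms(4,7) E s(1) by (auto simp: is_fctr_def)
  have L1: "far L (Ident C (fob R B)) = Ident D E"
    using assms(3) RB by (auto simp: is_fctr_def E_def)
  have "\<phi> (fob R B) E (Comp D s e)
      = \<phi> (fob R B) E (Comp D s (Comp D e (far L (Ident C (fob R B)))))"
    using D.Ident_right[OF e(1)] by (simp add: L1)
  also have "\<dots> = Comp C (far R s) (Comp C (\<phi> (fob R B) B e) (Ident C (fob R B)))"
    using nat[OF RB RB assms(7) E C.Ident_Hom[OF RB] s(1)] e(1) by (simp add: E_def)
  also have "\<dots> = \<phi> (fob R B) E (Ident D E)"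
    using C.Ident_right[OF Rs] C.Ident_left[OF C.Ident_Hom[OF RB]] by (simp add: e(2) s(2)[symmetric])
  finally have "Comp D s e = Ident D E"
    using bij[OF RB E] D.Comp_Hom[OF e(1) s(1)] D.Ident_Hom[OF E]
    by (metis E_def bij_betw_def inj_onD)
  with e(1) s(1) show thesis unfolding E_def by (rule that)
qed

section \<open>Zero morphisms and shifts\<close>

context additive_cat
begin

lemma Hom_Obj: "f \<in> Hom C A B \<Longrightarrow> A \<in> Obj C \<and> B \<in> Obj C"
  using Dom_Cod by (auto simp: Hom_def)

lemma Zero_Hom:
  assumes "A \<in> Obj C" "B \<in> Obj C"
  shows "Zero C A B \<in> Hom C A B"
proof -
  interpret G: comm_group "hom_group C A B" using Hom_group assms by blast
  show ?thesis using G.one_closed by (simp add: hom_group_def)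
qed

lemma Add_Zero:
  assumes "A \<in> Obj C" "B \<in> Obj C"
  shows "Add C (Zero C A B) (Zero C A B) = Zero C A B"
proof -
  interpret G: comm_group "hom_group C A B" using Hom_group assms by blast
  show ?thesis using G.l_one[OF G.one_closed] by (simp add: hom_group_def)
qed

lemma Add_idem_Zero:
  assumes "f \<in> Hom C A B" "Add C f f = f"
  shows "f = Zero C A B"
proof -
  interpret G: comm_group "hom_group C A B" using Hom_group Hom_Obj[OF assms(1)] by blast
  have f: "f \<in> carrier (hom_group C A B)" using assms by (simp add: hom_group_def)
  have "f \<otimes>\<^bsub>hom_group C A B\<^esub> f = f" using assms by (simp add: hom_group_def)
  then have "f = \<one>\<^bsub>hom_group C A B\<^esub>" using G.l_cancel_one[OF f f] by simp
  then show ?thesis by (simp add: hom_group_def)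
qed

lemma Comp_Zero:
  assumes "g \<in> Hom C B E" "A \<in> Obj C"
  shows "g \<cdot> Zero C A B = Zero C A E"
proof -
  have B: "B \<in> Obj C" using Hom_Obj assms by blast
  note z = Zero_Hom[OF assms(2) B]
  show ?thesis
    using Add_Comp[OF z z assms(1)] Add_Zero[OF assms(2) B] Comp_Hom[OF z assms(1)]
    by (metis Add_idem_Zero)
qed

lemma Zero_Comp:
  assumes "f \<in> Hom C A B" "E \<in> Obj C"
  shows "Zero C B E \<cdot> f = Zero C A E"
proof -
  have B: "B \<in> Obj C" using Hom_Obj assms by blast
  note z = Zero_Hom[OF B assms(2)]
  show ?thesis
    using Comp_Add[OF assms(1) z z] Add_Zero[OF B assms(2)] Comp_Hom[OF assms(1) z]
    by (metis Add_idem_Zero)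
qed

lemma Neg_Hom:
  assumes "f \<in> Hom C A B"
  shows "Neg C f \<in> Hom C A B"
proof -
  interpret G: comm_group "hom_group C A B" using Hom_group Hom_Obj[OF assms(1)] by blast
  have "f \<in> carrier (hom_group C A B)" using assms by (simp add: hom_group_def)
  from G.inv_closed[OF this] show ?thesis
    using assms by (simp add: Neg_def hom_group_def Hom_def)
qed

lemma Neg_eqD:
  assumes "f \<in> Hom C A B" "g \<in> Hom C A B" "Neg C f = Neg C g"
  shows "f = g"
proof -
  interpret G: comm_group "hom_group C A B" using Hom_group Hom_Obj[OF assms(1)] by blast
  have "f \<in> carrier (hom_group C A B)" "g \<in> carrier (hom_group C A B)"
    using assms by (simp_all add: hom_group_def)
  moreover have "Neg C f = inv\<^bsub>hom_group C A B\<^esub> f" "Neg C g = inv\<^bsub>hom_group C A B\<^esub> g"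
    using assms by (simp_all add: Neg_def Hom_def)
  ultimately show ?thesis using assms(3) by (metis G.inv_inv)
qed

lemma Neg_Zero:
  assumes "A \<in> Obj C" "B \<in> Obj C"
  shows "Neg C (Zero C A B) = Zero C A B"
proof -
  interpret G: comm_group "hom_group C A B" using Hom_group assms by blast
  have "Dom C (Zero C A B) = A" "Cod C (Zero C A B) = B"
    using Zero_Hom[OF assms] by (auto simp: Hom_def)
  then show ?thesis using G.inv_one by (simp add: Neg_def hom_group_def)
qed

lemma Neg_unique:
  assumes "f \<in> Hom C A B" "g \<in> Hom C A B" "Add C g f = Zero C A B"
  shows "g = Neg C f"
proof -
  interpret G: comm_group "hom_group C A B" using Hom_group Hom_Obj[OF assms(1)] by blast
  have "inv\<^bsub>hom_group C A B\<^esub> f = g"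
    by (rule G.inv_equality) (use assms in \<open>simp_all add: hom_group_def\<close>)
  then show ?thesis using assms by (simp add: Neg_def Hom_def)
qed

lemma Add_Neg:
  assumes "f \<in> Hom C A B"
  shows "Add C (Neg C f) f = Zero C A B"
proof -
  interpret G: comm_group "hom_group C A B" using Hom_group Hom_Obj[OF assms(1)] by blast
  have "f \<in> carrier (hom_group C A B)" using assms by (simp add: hom_group_def)
  from G.l_inv[OF this] show ?thesis
    using assms by (simp add: Neg_def hom_group_def Hom_def)
qed

lemma Neg_Comp:
  assumes "f \<in> Hom C A B" "g \<in> Hom C B E"
  shows "Neg C g \<cdot> f = Neg C (g \<cdot> f)"
proof (rule Neg_unique)
  show "g \<cdot> f \<in> Hom C A E" "Neg C g \<cdot> f \<in> Hom C A E"
    using assms Neg_Hom Comp_Hom by blast+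
  show "Add C (Neg C g \<cdot> f) (g \<cdot> f) = Zero C A E"
    using Comp_Add[OF assms(1) Neg_Hom[OF assms(2)] assms(2)] Add_Neg[OF assms(2)]
      Zero_Comp[OF assms(1)] Hom_Obj[OF assms(2)] by simp
qed

lemma Comp_Neg:
  assumes "f \<in> Hom C A B" "g \<in> Hom C B E"
  shows "g \<cdot> Neg C f = Neg C (g \<cdot> f)"
proof (rule Neg_unique)
  show "g \<cdot> f \<in> Hom C A E" "g \<cdot> Neg C f \<in> Hom C A E"
    using assms Neg_Hom Comp_Hom by blast+
  show "Add C (g \<cdot> Neg C f) (g \<cdot> f) = Zero C A E"
    using Add_Comp[OF Neg_Hom[OF assms(1)] assms] Add_Neg[OF assms(1)]
      Comp_Zero[OF assms(2)] Hom_Obj[OF assms(1)] by simp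
qed

lemma orth_is_zero:
  assumes "is_zero C Z" "A \<in> Obj C"
  shows "orth C A Z"
proof -
  have Z: "Z \<in> Obj C" "Ident C Z = Zero C Z Z" using assms(1) by (auto simp: is_zero_def)
  have "f = Zero C A Z" if "f \<in> Hom C A Z" for f
    using Ident_left[OF that] Zero_Comp[OF that Z(1)] Z(2) by simp
  then show ?thesis using Zero_Hom[OF assms(2) Z(1)] by blast
qed

lemma orth_retract:
  assumes "orth C A B" "e \<in> Hom C B' B" "s \<in> Hom C B B'" "s \<cdot> e = Ident C B'" "A \<in> Obj C"
  shows "orth C A B'"
proof (rule orthI)
  show "Zero C A B' \<in> Hom C A B'" using Zero_Hom Hom_Obj assms by blast
  fix f g assume fg: "f \<in> Hom C A B'" "g \<in> Hom C A B'"
  have eq: "s \<cdot> (e \<cdot> k) = k" if "k \<in> Hom C A B'" for k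
    using Comp_assoc[OF that assms(2,3)] assms(4) Ident_left[OF that] by simp
  have "e \<cdot> f = e \<cdot> g"
    using orthD[OF assms(1) Comp_Hom[OF _ assms(2)] Comp_Hom[OF _ assms(2)]] fg by blast
  then show "f = g" using eq fg by metis
qed

lemma orth_direct_sum:
  assumes "direct_sum C A A' E" "B \<in> Obj C"
  shows "orth C E B \<longleftrightarrow> orth C A B \<and> orth C A' B"
proof -
  obtain i j p q where ob: "A \<in> Obj C" "A' \<in> Obj C" "E \<in> Obj C"
    and m: "i \<in> Hom C A E" "j \<in> Hom C A' E" "p \<in> Hom C E A" "q \<in> Hom C E A'"
    and eq: "p \<cdot> i = Ident C A" "q \<cdot> j = Ident C A'" "Add C (i \<cdot> p) (j \<cdot> q) = Ident C E"
    using assms(1) unfolding direct_sum_def by blast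
  have retract: "orth C K B" if E: "orth C E B" and r: "k \<in> Hom C K E" "l \<in> Hom C E K"
    "l \<cdot> k = Ident C K" for K k l
  proof (rule orthI)
    show "Zero C K B \<in> Hom C K B" using Zero_Hom Hom_Obj assms(2) r by blast
    fix f g assume fg: "f \<in> Hom C K B" "g \<in> Hom C K B"
    have "f \<cdot> l = g \<cdot> l" using orthD[OF E Comp_Hom[OF r(2)] Comp_Hom[OF r(2)]] fg by blast
    then show "f = g" using Comp_assoc[OF r(1,2)] Ident_right fg r(3) by metis
  qed
  have "orth C E B" if K: "orth C A B" "orth C A' B"
  proof (rule orthI)
    show "Zero C E B \<in> Hom C E B" using Zero_Hom ob assms(2) by blast
    fix f g assume fg: "f \<in> Hom C E B" "g \<in> Hom C E B"
    have split: "k = Add C ((k \<cdot> i) \<cdot> p) ((k \<cdot> j) \<cdot> q)" if k: "k \<in> Hom C E B" for k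
      using Ident_right[OF k] Add_Comp[OF Comp_Hom[OF m(3,1)] Comp_Hom[OF m(4,2)] k]
        Comp_assoc[OF m(3,1) k] Comp_assoc[OF m(4,2) k] eq(3) by simp
    have eqs: "f \<cdot> i = g \<cdot> i" "f \<cdot> j = g \<cdot> j"
      using orthD[OF K(1) Comp_Hom[OF m(1)] Comp_Hom[OF m(1)]]
        orthD[OF K(2) Comp_Hom[OF m(2)] Comp_Hom[OF m(2)]] fg by blast+
    have "f = Add C ((g \<cdot> i) \<cdot> p) ((g \<cdot> j) \<cdot> q)"
      by (rule split[OF fg(1), unfolded eqs])
    also have "\<dots> = g" by (rule split[OF fg(2), symmetric])
    finally show "f = g" .
  qed
  then show ?thesis using retract m eq by blast
qed

lemma orth_coproduct:
  assumes "is_coproduct C J F P \<iota>" "\<And>j. j \<in> J \<Longrightarrow> orth C (F j) B" "B \<in> Obj C"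
  shows "orth C P B"
proof (rule orthI)
  have P: "P \<in> Obj C" "\<And>j. j \<in> J \<Longrightarrow> \<iota> j \<in> Hom C (F j) P"
    and univ: "\<And>f. (\<forall>j \<in> J. f j \<in> Hom C (F j) B) \<Longrightarrow>
        (\<exists>!g. g \<in> Hom C P B \<and> (\<forall>j \<in> J. Comp C g (\<iota> j) = f j))"
    using assms(1,3) unfolding is_coproduct_def by blast+
  show "Zero C P B \<in> Hom C P B" using Zero_Hom P assms(3) by blast
  fix f g assume fg: "f \<in> Hom C P B" "g \<in> Hom C P B"
  have "\<forall>j\<in>J. f \<cdot> \<iota> j \<in> Hom C (F j) B" using fg P(2) Comp_Hom by blast
  moreover have "\<forall>j\<in>J. g \<cdot> \<iota> j = f \<cdot> \<iota> j" 
    using orthD[OF assms(2) Comp_Hom[OF P(2)] Comp_Hom[OF P(2)]] fg by blast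
  ultimately show "f = g" using univ[of "\<lambda>j. f \<cdot> \<iota> j"] fg by blast
qed

end

context suspended_cat
begin

lemma Sob_Obj: "A \<in> Obj C \<Longrightarrow> Sob C A \<in> Obj C"
  using Sob_bij bij_betwE by blast

lemma Sob_surj:
  assumes "A \<in> Obj C"
  obtains A' where "A' \<in> Obj C" "Sob C A' = A"
  using assms Sob_bij by (metis bij_betw_imp_surj_on imageE)

lemma Sar_Hom: "f \<in> Hom C A B \<Longrightarrow> Sar C f \<in> Hom C (Sob C A) (Sob C B)"
  using Sar_bij Hom_Obj bij_betwE by metis

lemma Sar_surj:
  assumes "f \<in> Hom C (Sob C A) (Sob C B)" "A \<in> Obj C" "B \<in> Obj C"
  obtains f' where "f' \<in> Hom C A B" "Sar C f' = f"
  using assms Sar_bij by (metis bij_betw_imp_surj_on imageE)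

lemma Sar_inj: "f \<in> Hom C A B \<Longrightarrow> g \<in> Hom C A B \<Longrightarrow> Sar C f = Sar C g \<Longrightarrow> f = g"
  using Sar_bij Hom_Obj by (metis bij_betw_def inj_onD)

lemma Sar_Zero: "A \<in> Obj C \<Longrightarrow> B \<in> Obj C \<Longrightarrow> Sar C (Zero C A B) = Zero C (Sob C A) (Sob C B)"
  using Sar_Add[OF Zero_Hom Zero_Hom] Add_Zero Sar_Hom[OF Zero_Hom] Add_idem_Zero by metis

lemma is_zero_Sob: "is_zero C Z \<Longrightarrow> is_zero C (Sob C Z)"
  using Sob_Obj Sar_Ident Sar_Zero unfolding is_zero_def by metis

lemma orth_Sob:
  assumes "A \<in> Obj C" "B \<in> Obj C"
  shows "orth C (Sob C A) (Sob C B) \<longleftrightarrow> orth C A B"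
  using bij_betw_orth[OF Sar_bij[OF assms] Zero_Hom[OF assms] Zero_Hom[OF Sob_Obj Sob_Obj]] assms
  by blast

lemma shift_0 [simp]: "shift C 0 A = A"
  by (simp add: shift_def)

lemma shift_int: "shift C (int n) A = (Sob C ^^ n) A"
  by (simp add: shift_def)

lemma funpow_Sob_Obj: "A \<in> Obj C \<Longrightarrow> (Sob C ^^ n) A \<in> Obj C"
  by (induction n) (auto intro: Sob_Obj)

lemma funpow_inv_Sob_Obj: "A \<in> Obj C \<Longrightarrow> (inv_into (Obj C) (Sob C) ^^ n) A \<in> Obj C"
  using Sob_bij by (induction n) (auto simp: bij_betw_def inv_into_into)

lemma shift_Obj: "A \<in> Obj C \<Longrightarrow> shift C n A \<in> Obj C"
  by (simp add: shift_def funpow_Sob_Obj funpow_inv_Sob_Obj)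

lemma shift_Sob:
  assumes "A \<in> Obj C"
  shows "shift C n (Sob C A) = shift C (n + 1) A"
proof (cases "0 \<le> n")
  case True
  then have "nat (n + 1) = Suc (nat n)" by simp
  then show ?thesis using True by (simp add: shift_def funpow_swap1)
next
  case False
  then have m: "nat (- n) = Suc (nat (- (n + 1)))" by simp
  have "inv_into (Obj C) (Sob C) (Sob C A) = A"
    using assms Sob_bij by (metis bij_betw_def inv_into_f_f)
  then show ?thesis using False m
    by (auto simp: shift_def funpow_Suc_right simp del: funpow.simps)
qed

lemma Sob_shift:
  assumes "A \<in> Obj C"
  shows "Sob C (shift C n A) = shift C (n + 1) A"
proof (cases "0 \<le> n")
  case True
  then have "nat (n + 1) = Suc (nat n)" by simp
  then show ?thesis using True by (simp add: shift_def)
next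
  case False
  then have m: "nat (- n) = Suc (nat (- (n + 1)))" by simp
  have "Sob C (inv_into (Obj C) (Sob C) B) = B" if "B \<in> Obj C" for B
    using that Sob_bij by (metis bij_betw_imp_surj_on f_inv_into_f)
  then show ?thesis using False m funpow_inv_Sob_Obj[OF assms]
    by (auto simp: shift_def)
qed

lemma orth_shift:
  assumes "A \<in> Obj C" "B \<in> Obj C"
  shows "orth C A (shift C n B) \<longleftrightarrow> orth C (shift C (- n) A) B"
  using assms(1)
proof (induction n arbitrary: A rule: int_induct[where k = 0])
  case base
  then show ?case by simp
next
  case (step1 n)
  obtain A' where A': "A' \<in> Obj C" "Sob C A' = A" using Sob_surj step1.prems by blast
  have "orth C A (shift C (n + 1) B) \<longleftrightarrow> orth C A' (shift C n B)"
    using orth_Sob[OF A'(1) shift_Obj[OF assms(2)]] by (simp add: A' Sob_shift assms(2))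
  also have "\<dots> \<longleftrightarrow> orth C (shift C (- n) A') B" using step1.IH A' by blast
  also have "shift C (- n) A' = shift C (- (n + 1)) A"
    using shift_Sob[OF A'(1), of "- (n + 1)"] A'(2) by simp
  finally show ?case .
next
  case (step2 n)
  have "orth C A (shift C (n - 1) B) \<longleftrightarrow> orth C (Sob C A) (shift C n B)"
    using orth_Sob[OF step2.prems shift_Obj[OF assms(2)], of "n - 1"]
    by (simp add: Sob_shift assms(2))
  also have "\<dots> \<longleftrightarrow> orth C (shift C (- n) (Sob C A)) B"
    using step2.IH Sob_Obj[OF step2.prems] by blast
  also have "shift C (- n) (Sob C A) = shift C (- (n - 1)) A"
    using shift_Sob[OF step2.prems] by simp
  finally show ?case .
qed

lemma rperp_Sob_iff: "A \<in> Obj C \<Longrightarrow> Sob C A \<in> rperp C \<C> UNIV \<longleftrightarrow> A \<in> rperp C \<C> UNIV"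
proof -
  assume A: "A \<in> Obj C"
  have "(\<forall>n. orth C T (shift C (n + 1) A)) \<longleftrightarrow> (\<forall>n. orth C T (shift C n A))" for T
    by (metis diff_add_cancel)
  then show ?thesis using A Sob_Obj[OF A] by (simp add: rperp_def shift_Sob)
qed

lemma orth_iso:
  assumes "is_iso_arr C f" "f \<in> Hom C B B'" "A \<in> Obj C"
  shows "orth C A B \<longleftrightarrow> orth C A B'"
proof -
  obtain g where g: "g \<in> Hom C B' B" "g \<cdot> f = Ident C B" "f \<cdot> g = Ident C B'"
    using assms by (auto simp: is_iso_arr_def Hom_def)
  show ?thesis
    using orth_retract[OF _ g(1) assms(2) g(3) assms(3)] orth_retract[OF _ assms(2) g(1,2) assms(3)]
    by blast
qed

lemma funpow_Sar_Hom: "f \<in> Hom C A B \<Longrightarrow> (Sar C ^^ n) f \<in> Hom C ((Sob C ^^ n) A) ((Sob C ^^ n) B)"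
  by (induction n) (auto intro: Sar_Hom)

lemma funpow_Sar_Ident: "A \<in> Obj C \<Longrightarrow> (Sar C ^^ n) (Ident C A) = Ident C ((Sob C ^^ n) A)"
  by (induction n) (auto simp: Sar_Ident funpow_Sob_Obj)

lemma funpow_Sar_Comp:
  assumes "f \<in> Hom C A B" "g \<in> Hom C B E"
  shows "(Sar C ^^ n) (g \<cdot> f) = (Sar C ^^ n) g \<cdot> (Sar C ^^ n) f"
  by (induction n) (use assms in \<open>auto simp: Sar_Comp[OF funpow_Sar_Hom funpow_Sar_Hom]\<close>)

end

section \<open>Exactness of Hom on triangles\<close>

context triangulated_cat
begin

lemma Tri_Hom:
  assumes "(u, v, w) \<in> Tri C"
  shows "u \<in> Hom C (Dom C u) (Dom C v)" "v \<in> Hom C (Dom C v) (Dom C w)"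
    "w \<in> Hom C (Dom C w) (Sob C (Dom C u))"
  using Tri_candidate[OF assms] by (auto simp: candidate_def Hom_def)

lemma Tri_rotateD: "(u, v, w) \<in> Tri C \<Longrightarrow> (v, w, Neg C (Sar C u)) \<in> Tri C"
  using Tri_rotate Tri_candidate by blast

lemma Tri_Zero_Ident:
  assumes "B \<in> Obj C" "is_zero C Z"
  shows "(Zero C Z B, Ident C B, Zero C B (Sob C Z)) \<in> Tri C"
proof -
  have Z: "Z \<in> Obj C" using assms(2) by (simp add: is_zero_def)
  note z = Zero_Hom[OF Z assms(1)] Ident_Hom[OF assms(1)] Zero_Hom[OF assms(1) Sob_Obj[OF Z]]
  have "candidate C (Zero C Z B) (Ident C B) (Zero C B (Sob C Z))"
    using z by (auto simp: candidate_def Hom_def)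
  moreover have "Neg C (Sar C (Zero C Z B)) = Zero C (Sob C Z) (Sob C B)"
    using Z assms(1) by (simp add: Sar_Zero Neg_Zero Sob_Obj)
  ultimately show ?thesis
    using Tri_rotate Tri_Ident[OF assms(1) is_zero_Sob[OF assms(2)]] by metis
qed

text \<open>Exactness of \<open>Hom(-, W)\<close>: a morphism that vanishes on the first arrow factors through the
  second one. It comes from a morphism to the triangle \<open>0 \<rightarrow> W \<rightarrow> W \<rightarrow> 0\<close>.\<close>

lemma Tri_factor_right:
  assumes "(u, v, w) \<in> Tri C" "f \<in> Hom C (Dom C v) W" "f \<cdot> u = Zero C (Dom C u) W"
  obtains h where "h \<in> Hom C (Dom C w) W" "f = h \<cdot> v"
proof -
  obtain Z where Z: "is_zero C Z" "Z \<in> Obj C" using zero_ex by (auto simp: is_zero_def)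
  have W: "W \<in> Obj C" and A: "Dom C u \<in> Obj C"
    using Hom_Obj assms(2) Hom_Obj[OF Tri_Hom(1)[OF assms(1)]] by blast+
  have dom: "Dom C (Zero C Z W) = Z" "Dom C (Ident C W) = W" "Dom C (Zero C W (Sob C Z)) = W"
    using Zero_Hom[OF Z(2) W] Ident_Hom[OF W] Zero_Hom[OF W Sob_Obj[OF Z(2)]]
    by (auto simp: Hom_def)
  have "Zero C Z W \<cdot> Zero C (Dom C u) Z = f \<cdot> u"
    using Comp_Zero[OF Zero_Hom[OF Z(2) W] A] assms(3) by simp
  then obtain h where "h \<in> Hom C (Dom C w) W" "Ident C W \<cdot> f = h \<cdot> v"
    using Tri_morphism[OF assms(1) Tri_Zero_Ident[OF W Z(1)], of "Zero C (Dom C u) Z" f]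
      Zero_Hom[OF A Z(2)] assms(2) by (auto simp: dom)
  then show thesis using that Ident_left[OF assms(2)] by simp
qed

text \<open>Exactness of \<open>Hom(W, -)\<close>, from a morphism out of the triangle \<open>W \<rightarrow> 0 \<rightarrow> W[1] \<rightarrow> W[1]\<close>.\<close>

lemma Tri_factor_left:
  assumes "(u, v, w) \<in> Tri C" "f \<in> Hom C W (Dom C v)" "v \<cdot> f = Zero C W (Dom C w)"
  obtains h where "h \<in> Hom C W (Dom C u)" "f = u \<cdot> h"
proof -
  obtain Z where Z: "is_zero C Z" "Z \<in> Obj C" using zero_ex by (auto simp: is_zero_def)
  note H = Tri_Hom[OF assms(1)]
  have W: "W \<in> Obj C" and A: "Dom C u \<in> Obj C" and E: "Dom C w \<in> Obj C"
    using Hom_Obj assms(2) H by blast+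
  note I = Ident_Hom[OF Sob_Obj[OF W]]
  have N: "Neg C (Sar C (Ident C W)) = Neg C (Ident C (Sob C W))" using W by (simp add: Sar_Ident)
  have T: "(Zero C W Z, Zero C Z (Sob C W), Neg C (Ident C (Sob C W))) \<in> Tri C"
    using Tri_rotateD[OF Tri_Ident[OF W Z(1)]] by (simp add: N)
  have dom: "Dom C (Zero C W Z) = W" "Dom C (Zero C Z (Sob C W)) = Z"
    "Dom C (Neg C (Ident C (Sob C W))) = Sob C W" "Dom C (Neg C (Sar C u)) = Sob C (Dom C u)"
    using Zero_Hom[OF W Z(2)] Zero_Hom[OF Z(2) Sob_Obj[OF W]] Neg_Hom[OF I]
      Neg_Hom[OF Sar_Hom[OF H(1)]] by (auto simp: Hom_def)
  have "v \<cdot> f = Zero C Z (Dom C w) \<cdot> Zero C W Z"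
    using Comp_Zero[OF Zero_Hom[OF Z(2) E] W] assms(3) by simp
  then obtain h where h: "h \<in> Hom C (Sob C W) (Sob C (Dom C u))"
    "Neg C (Sar C u) \<cdot> h = Sar C f \<cdot> Neg C (Ident C (Sob C W))"
    using Tri_morphism[OF T Tri_rotateD[OF assms(1)], of f "Zero C Z (Dom C w)"]
      Zero_Hom[OF Z(2) E] assms(2) by (auto simp: dom)
  obtain h' where h': "h' \<in> Hom C W (Dom C u)" "Sar C h' = h"
    using Sar_surj[OF h(1) W A] by blast
  have "Neg C (Sar C u \<cdot> h) = Neg C (Sar C f)"
    using h Neg_Comp[OF h(1) Sar_Hom[OF H(1)]] Comp_Neg[OF I Sar_Hom[OF assms(2)]]
      Ident_right[OF Sar_Hom[OF assms(2)]] by simp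
  then have "Sar C (u \<cdot> h') = Sar C f"
    using Neg_eqD[OF Comp_Hom[OF h(1) Sar_Hom[OF H(1)]] Sar_Hom[OF assms(2)]]
      Sar_Comp[OF h'(1) H(1)] h'(2) by simp
  then have "u \<cdot> h' = f" using Sar_inj Comp_Hom[OF h'(1) H(1)] assms(2) by blast
  then show thesis using that h'(1) by blast
qed

lemma Tri_Comp_Zero:
  assumes "(u, v, w) \<in> Tri C"
  shows "v \<cdot> u = Zero C (Dom C u) (Dom C w)"
proof -
  obtain Z where Z: "is_zero C Z" "Z \<in> Obj C" using zero_ex by (auto simp: is_zero_def)
  note H = Tri_Hom[OF assms]
  have A: "Dom C u \<in> Obj C" and E: "Dom C w \<in> Obj C" using Hom_Obj H by blast+
  have dom: "Dom C (Ident C (Dom C u)) = Dom C u" "Dom C (Zero C (Dom C u) Z) = Dom C u"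
    "Dom C (Zero C Z (Sob C (Dom C u))) = Z"
    using Ident_Hom[OF A] Zero_Hom[OF A Z(2)] Zero_Hom[OF Z(2) Sob_Obj[OF A]]
    by (auto simp: Hom_def)
  obtain h where "h \<in> Hom C Z (Dom C w)" "v \<cdot> u = h \<cdot> Zero C (Dom C u) Z"
    using Tri_morphism[OF Tri_Ident[OF A Z(1)] assms, of "Ident C (Dom C u)" u] H(1)
      Ident_Hom[OF A] by (auto simp: dom)
  then show ?thesis using Comp_Zero A by metis
qed

text \<open>If \<open>P\<close> and \<open>P[1]\<close> have no morphism to \<open>W\<close>, then the triangle identifies morphisms from \<open>E\<close>
  and from \<open>K[1]\<close> to \<open>W\<close>.\<close>

lemma orth_Tri_iff:
  assumes "(u, v, w) \<in> Tri C" "u \<in> Hom C K P" "w \<in> Hom C E (Sob C K)"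
    and "orth C P W" "orth C (Sob C P) W" "W \<in> Obj C"
  shows "orth C (Sob C K) W \<longleftrightarrow> orth C E W"
proof -
  have dom: "Dom C u = K" "Dom C v = P" "Dom C w = E"
    using assms(2,3) Tri_Hom(1)[OF assms(1)] by (auto simp: Hom_def)
  note H = Tri_Hom[OF assms(1), unfolded dom]
  have ob: "K \<in> Obj C" "P \<in> Obj C" "E \<in> Obj C" using Hom_Obj H by blast+
  note R1 = Tri_rotateD[OF assms(1)] and R2 = Tri_rotateD[OF Tri_rotateD[OF assms(1)]]
  have Su: "Neg C (Sar C u) \<in> Hom C (Sob C K) (Sob C P)" using Neg_Hom Sar_Hom H(1) by blast
  have Sv: "Neg C (Sar C v) \<in> Hom C (Sob C P) (Sob C E)" using Neg_Hom Sar_Hom H(2) by blast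
  have dom2: "Dom C (Neg C (Sar C u)) = Sob C K" "Dom C (Neg C (Sar C v)) = Sob C P"
    using Su Sv by (auto simp: Hom_def)
  show ?thesis
  proof
    assume K: "orth C (Sob C K) W"
    have "f = Zero C E W" if f: "f \<in> Hom C E W" for f
    proof -
      have "f \<cdot> v = Zero C P W" using Comp_Hom[OF H(2) f] assms(4) by blast
      then obtain h where "h \<in> Hom C (Sob C K) W" "f = h \<cdot> w"
        using Tri_factor_right[OF R1, unfolded dom dom2, OF f] by metis
      then show ?thesis using K Zero_Comp[OF H(3) assms(6)] by simp
    qed
    then show "orth C E W" using Zero_Hom ob assms(6) by blast
  next
    assume E: "orth C E W"
    have "f = Zero C (Sob C K) W" if f: "f \<in> Hom C (Sob C K) W" for f
    proof -
      have "f \<cdot> w = Zero C E W" using Comp_Hom[OF H(3) f] E by blast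
      then obtain h where "h \<in> Hom C (Sob C P) W" "f = h \<cdot> Neg C (Sar C u)"
        using Tri_factor_right[OF R2, unfolded dom dom2, OF f] by metis
      then show ?thesis using assms(5) Zero_Comp[OF Su assms(6)] by simp
    qed
    then show "orth C (Sob C K) W" using Zero_Hom Sob_Obj ob assms(6) by blast
  qed
qed

end

section \<open>Orthogonal classes\<close>

lemma Zero_Hom_full_sub:
  "additive_cat C \<Longrightarrow> A \<in> Obj (full_sub C S) \<Longrightarrow> B \<in> Obj (full_sub C S) \<Longrightarrow>
    Zero (full_sub C S) A B \<in> Hom (full_sub C S) A B"
  by (simp add: Hom_full_sub additive_cat.Zero_Hom)

lemma lperp_0: "lperp C \<C> {0} = {A \<in> Obj C. \<forall>B \<in> \<C>. orth C A B}"
  by (simp add: lperp_def shift_def)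

context suspended_cat
begin

lemma rperp_nonneg_iff:
  "B \<in> rperp C {A} {0..} \<longleftrightarrow> B \<in> Obj C \<and> (\<forall>n. orth C A ((Sob C ^^ n) B))"
proof -
  have "(\<forall>i\<in>{0..}. orth C A (shift C i B)) \<longleftrightarrow> (\<forall>n. orth C A (shift C (int n) B))"
    by (metis atLeast_iff of_nat_0_le_iff zero_le_imp_eq_int)
  then show ?thesis by (simp add: rperp_def shift_int)
qed

lemma shift_mem_iff:
  assumes "\<And>A. A \<in> Obj C \<Longrightarrow> Sob C A \<in> S \<longleftrightarrow> A \<in> S" "A \<in> Obj C"
  shows "shift C n A \<in> S \<longleftrightarrow> A \<in> S"
proof (induction n rule: int_induct[where k = 0])
  case (step1 n)
  then show ?case using assms Sob_shift shift_Obj by metis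
next
  case (step2 n)
  have "Sob C (shift C (n - 1) A) = shift C n A" using Sob_shift[OF assms(2)] by simp
  then show ?case using step2 assms shift_Obj by metis
qed simp

lemma rperp_full_sub_iff:
  assumes "\<And>A. A \<in> Obj C \<Longrightarrow> Sob C A \<in> S \<longleftrightarrow> A \<in> S" "A \<in> S"
  shows "B \<in> rperp (full_sub C S) {A} {0..} \<longleftrightarrow> B \<in> S \<and> B \<in> rperp C {A} {0..}"
  using shift_mem_iff[OF assms(1)] assms(2)
  by (auto simp: rperp_def shift_full_sub_nonneg Hom_full_sub)

lemma rperp_retract:
  assumes "B \<in> rperp C {A} {0..}" "e \<in> Hom C B' B" "s \<in> Hom C B B'" "s \<cdot> e = Ident C B'"
    and "A \<in> Obj C"
  shows "B' \<in> rperp C {A} {0..}"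
proof -
  have B': "B' \<in> Obj C" using Hom_Obj assms(2) by blast
  have "orth C A ((Sob C ^^ n) B')" for n
  proof (rule orth_retract)
    show "orth C A ((Sob C ^^ n) B)" using assms(1) by (simp add: rperp_nonneg_iff)
    show "(Sar C ^^ n) s \<cdot> (Sar C ^^ n) e = Ident C ((Sob C ^^ n) B')"
      using funpow_Sar_Comp[OF assms(2,3)] funpow_Sar_Ident[OF B'] assms(4) by metis
  qed (use assms funpow_Sar_Hom in blast)+
  then show ?thesis using B' by (simp add: rperp_nonneg_iff)
qed

lemma rperp_is_zero:
  assumes "is_zero C Z" "A \<in> Obj C"
  shows "Z \<in> rperp C {A} {0..}"
proof -
  have "is_zero C ((Sob C ^^ n) Z)" for n
    using assms(1) by (induction n) (auto intro: is_zero_Sob)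
  then show ?thesis
    using assms orth_is_zero by (auto simp: rperp_nonneg_iff is_zero_def)
qed

text \<open>The comparison isomorphisms \<open>F (A[1]) \<cong> (F A)[1]\<close> of a triangle functor let nonnegative
  shifts pass through it.\<close>

lemma orth_triangle_fctr_funpow:
  assumes "triangle_fctr C (full_sub C S) F" "Z \<in> Obj C" "A \<in> Obj C"
  shows "orth C A (fob F ((Sob C ^^ n) Z)) \<longleftrightarrow> orth C A ((Sob C ^^ n) (fob F Z))"
  using assms(3)
proof (induction n arbitrary: A)
  case 0
  then show ?case by simp
next
  case (Suc n)
  obtain A' where A': "A' \<in> Obj C" "Sob C A' = A" using Sob_surj Suc.prems by blast
  let ?Z = "(Sob C ^^ n) Z"
  have Z: "?Z \<in> Obj C" using funpow_Sob_Obj assms(2) by blast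
  obtain \<theta> where \<theta>: "is_iso_arr (full_sub C S) \<theta>"
    "\<theta> \<in> Hom (full_sub C S) (fob F (Sob C ?Z)) (Sob C (fob F ?Z))"
    using assms(1) Z by (auto simp: triangle_fctr_def)
  have FZ: "fob F ?Z \<in> Obj C" "fob F Z \<in> Obj C"
    using assms(1,2) Z by (auto simp: triangle_fctr_def is_fctr_def)
  have "is_iso_arr C \<theta>" "\<theta> \<in> Hom C (fob F (Sob C ?Z)) (Sob C (fob F ?Z))"
    using \<theta> by (auto simp: is_iso_arr_def Hom_def full_sub_def)
  then have "orth C A (fob F (Sob C ?Z)) \<longleftrightarrow> orth C A (Sob C (fob F ?Z))"
    using Suc.prems by (rule orth_iso)
  also have "\<dots> \<longleftrightarrow> orth C A' (fob F ?Z)" using orth_Sob[OF A'(1) FZ(1)] A'(2) by simp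
  also have "\<dots> \<longleftrightarrow> orth C A' ((Sob C ^^ n) (fob F Z))" using Suc.IH A'(1) .
  also have "\<dots> \<longleftrightarrow> orth C A (Sob C ((Sob C ^^ n) (fob F Z)))"
    using orth_Sob[OF A'(1) funpow_Sob_Obj[OF FZ(2)]] A'(2) by simp
  finally show ?case by simp
qed

text \<open>A right adjoint \<open>R\<close> of the inclusion of \<open>S\<close> detects orthogonality to an object \<open>A\<close> of \<open>S\<close>:
  \<open>Hom(A, (R Z)[n]) \<cong> Hom(A, R (Z[n])) \<cong> Hom(A, Z[n])\<close>.\<close>

lemma rperp_coreflection_iff:
  assumes S: "\<And>A. A \<in> Obj C \<Longrightarrow> Sob C A \<in> S \<longleftrightarrow> A \<in> S"
    and adj: "adjoint_pair (full_sub C S) C L R"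
    and L: "is_inclusion (full_sub C S) L" and R: "triangle_fctr C (full_sub C S) R"
    and A: "A \<in> Obj C" "A \<in> S" and Z: "Z \<in> Obj C"
  shows "fob R Z \<in> rperp (full_sub C S) {A} {0..} \<longleftrightarrow> Z \<in> rperp C {A} {0..}"
proof -
  have RO: "fob R W \<in> Obj C" "fob R W \<in> S" if "W \<in> Obj C" for W
    using R that by (auto simp: triangle_fctr_def is_fctr_def)
  have LA: "fob L A = A" using L A by (simp add: is_inclusion_def)
  have "orth C A ((Sob C ^^ n) (fob R Z)) \<longleftrightarrow> orth C A ((Sob C ^^ n) Z)" for n
  proof -
    let ?Z = "(Sob C ^^ n) Z"
    have Zn: "?Z \<in> Obj C" using funpow_Sob_Obj Z by blast
    have "orth C A ?Z \<longleftrightarrow> orth (full_sub C S) A (fob R ?Z)"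
      using adjoint_pair_orth[OF adj, of A ?Z] A RO[OF Zn] Zn
      by (simp add: LA Zero_Hom Hom_full_sub)
    then show ?thesis
      using orth_triangle_fctr_funpow[OF R Z A(1)] A RO[OF Zn] by (simp add: Hom_full_sub)
  qed
  then show ?thesis
    using RO[OF Z] Z rperp_full_sub_iff[OF S A(2)] by (simp add: rperp_nonneg_iff)
qed

end

context triangulated_cat
begin

text \<open>There is a triangle \<open>T \<rightarrow> K \<rightarrow> P \<rightarrow> T[1]\<close> with \<open>P\<close> a coproduct of copies of \<open>B\<close>. For objects that
  are right orthogonal to \<open>B\<close> in degrees \<open>\<ge> 0\<close>, orthogonality to \<open>K\<close> and to \<open>T\<close> in these degrees
  is therefore the same.\<close>

lemma rperp_cocone_direct_sum:
  assumes P: "is_coproduct C J (\<lambda>_. B) P \<iota>" and \<alpha>: "\<alpha> \<in> Hom C P (shift C 1 T)"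
    and K: "is_cocone C \<alpha> K" and E: "direct_sum C K B E" and T: "T \<in> Obj C"
  shows "rperp C {E} {0..} = rperp C {B} {0..} \<inter> rperp C {T} {0..}"
proof -
  obtain u w where tri: "(u, \<alpha>, w) \<in> Tri C" and u: "Dom C u = K"
    using K by (auto simp: is_cocone_def)
  have T1: "shift C 1 T = Sob C T" using shift_int[of 1] by simp
  have dom: "Dom C \<alpha> = P" "Dom C w = Sob C T"
    using \<alpha> Tri_Hom(2)[OF tri] by (auto simp: Hom_def T1)
  note H = Tri_Hom[OF tri, unfolded u dom]
  have ob: "K \<in> Obj C" "P \<in> Obj C" using Hom_Obj H by blast+
  have K_iff: "orth C K W \<longleftrightarrow> orth C T W"
    if W: "W \<in> Obj C" "orth C B W" "orth C B (Sob C W)" for W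
  proof -
    have PW: "orth C P W" "orth C P (Sob C W)"
      using orth_coproduct[OF P] W Sob_Obj by blast+
    have "orth C K W \<longleftrightarrow> orth C (Sob C K) (Sob C W)" using orth_Sob ob W by blast
    also have "\<dots> \<longleftrightarrow> orth C (Sob C T) (Sob C W)"
      using orth_Tri_iff[OF tri H(1,3) PW(2)] PW(1) orth_Sob[OF ob(2) W(1)] Sob_Obj[OF W(1)]
      by blast
    also have "\<dots> \<longleftrightarrow> orth C T W" using orth_Sob T W by blast
    finally show ?thesis .
  qed
  have "(\<forall>n. orth C E ((Sob C ^^ n) W)) \<longleftrightarrow>
      (\<forall>n. orth C B ((Sob C ^^ n) W)) \<and> (\<forall>n. orth C T ((Sob C ^^ n) W))" if W: "W \<in> Obj C" for W
  proof -
    have "orth C E ((Sob C ^^ n) W) \<longleftrightarrow> orth C K ((Sob C ^^ n) W) \<and> orth C B ((Sob C ^^ n) W)" for n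
      using orth_direct_sum[OF E funpow_Sob_Obj[OF W]] .
    moreover have "orth C K ((Sob C ^^ n) W) \<longleftrightarrow> orth C T ((Sob C ^^ n) W)"
      if "\<forall>n. orth C B ((Sob C ^^ n) W)" for n
      using K_iff[OF funpow_Sob_Obj[OF W]] that that[rule_format, of "Suc n"] by simp
    ultimately show ?thesis by blast
  qed
  then show ?thesis by (auto simp: rperp_nonneg_iff)
qed

lemma Sob_Loc_iff: "A \<in> Obj C \<Longrightarrow> Sob C A \<in> Loc U C T \<longleftrightarrow> A \<in> Loc U C T"
  by (auto simp: Loc_def triangulated_sub_def)

section \<open>Gluing\<close>

text \<open>Gluing triangle: the cone of the counit of a coreflection onto \<open>S\<close> receives no nonzero
  morphism from \<open>S\<close>, since every morphism from \<open>S\<close> to \<open>Z\<close> factors uniquely through the counit and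
  \<open>S\<close> is closed under both shifts.\<close>

lemma coreflection_triangle:
  assumes S: "\<And>A. A \<in> Obj C \<Longrightarrow> Sob C A \<in> S \<longleftrightarrow> A \<in> S"
    and adj: "adjoint_pair (full_sub C S) C L R"
    and L: "is_fctr (full_sub C S) C L" "is_inclusion (full_sub C S) L"
    and R: "is_fctr C (full_sub C S) R" and Z: "Z \<in> Obj C"
  obtains \<epsilon> c d K where "(\<epsilon>, c, d) \<in> Tri C" "\<epsilon> \<in> Hom C (fob R Z) Z" "c \<in> Hom C Z K"
    "\<And>A. A \<in> Obj C \<Longrightarrow> A \<in> S \<Longrightarrow> orth C A K"
proof -
  have RZ: "fob R Z \<in> Obj C" "fob R Z \<in> S" using R Z by (auto simp: is_fctr_def)
  obtain \<epsilon> where \<epsilon>0: "\<epsilon> \<in> Hom C (fob L (fob R Z)) Z"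
    and bij: "\<And>A. A \<in> Obj (full_sub C S) \<Longrightarrow>
      bij_betw (\<lambda>g. \<epsilon> \<cdot> far L g) (Hom (full_sub C S) A (fob R Z)) (Hom C (fob L A) Z)"
    using adjoint_pair_counit[OF cat_full_sub[OF cat_axioms] cat_axioms L(1) R adj Z] by blast
  have \<epsilon>: "\<epsilon> \<in> Hom C (fob R Z) Z" using \<epsilon>0 L(2) RZ by (simp add: is_inclusion_def)
  have bij: "bij_betw (\<lambda>g. \<epsilon> \<cdot> g) (Hom C A (fob R Z)) (Hom C A Z)"
    if A: "A \<in> Obj C" "A \<in> S" for A
  proof -
    have "far L g = g" if "g \<in> Hom C A (fob R Z)" for g
      using that L(2) A RZ by (auto simp: is_inclusion_def Hom_def full_sub_def)
    then have "bij_betw (\<lambda>g. \<epsilon> \<cdot> far L g) (Hom C A (fob R Z)) (Hom C A Z)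
        = bij_betw (\<lambda>g. \<epsilon> \<cdot> g) (Hom C A (fob R Z)) (Hom C A Z)"
      by (intro bij_betw_cong) simp
    then show ?thesis
      using bij[of A] A RZ L(2) by (simp add: Hom_full_sub is_inclusion_def)
  qed
  obtain c d where tri: "(\<epsilon>, c, d) \<in> Tri C" using Tri_ex Hom_Arr[OF \<epsilon>] by blast
  define K where "K = Dom C d"
  have dom: "Dom C \<epsilon> = fob R Z" "Dom C c = Z" "Dom C d = K"
    using \<epsilon> Tri_Hom(1)[OF tri] by (auto simp: Hom_def K_def)
  note H = Tri_Hom[OF tri, unfolded dom]
  have K: "K \<in> Obj C" using Hom_Obj H(2) by blast
  have NS: "Neg C (Sar C \<epsilon>) \<in> Hom C (Sob C (fob R Z)) (Sob C Z)"
    using Neg_Hom[OF Sar_Hom[OF H(1)]] .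
  have domN: "Dom C (Neg C (Sar C \<epsilon>)) = Sob C (fob R Z)" using NS by (simp add: Hom_def)
  have domNc: "Dom C (Neg C (Sar C c)) = Sob C Z"
    using Neg_Hom[OF Sar_Hom[OF H(2)]] by (simp add: Hom_def)
  have "orth C A K" if A: "A \<in> Obj C" "A \<in> S" for A
  proof -
    have "f = Zero C A K" if f: "f \<in> Hom C A K" for f
    proof -
      obtain A' where A': "A' \<in> Obj C" "Sob C A' = A" using Sob_surj A(1) by blast
      have A'S: "A' \<in> S" using S[OF A'(1)] A A'(2) by simp
      have df: "d \<cdot> f \<in> Hom C A (Sob C (fob R Z))" using Comp_Hom[OF f H(3)] .
      obtain g where g: "g \<in> Hom C A' (fob R Z)" "Sar C g = d \<cdot> f"
        using Sar_surj[of "d \<cdot> f" A' "fob R Z"] df A' RZ by auto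
      \<comment> \<open>\<open>\<epsilon> g\<close> vanishes after shifting, as consecutive arrows of the triangle compose to zero.\<close>
      have "Neg C (Sar C \<epsilon>) \<cdot> d = Zero C K (Sob C Z)"
        using Tri_Comp_Zero[OF Tri_rotateD[OF tri[THEN Tri_rotateD]]]
          Tri_Comp_Zero[OF Tri_rotateD[OF tri]] by (simp add: dom domN domNc)
      then have "Neg C (Sar C \<epsilon>) \<cdot> (d \<cdot> f) = Zero C A (Sob C Z)"
        using Comp_assoc[OF f H(3) NS] Zero_Comp[OF f Sob_Obj[OF Z]] by simp
      then have "Neg C (Sar C (\<epsilon> \<cdot> g)) = Neg C (Zero C A (Sob C Z))"
        using Neg_Comp[OF df Sar_Hom[OF H(1)]] Sar_Comp[OF g(1) H(1)] g(2)
          Neg_Zero[OF A(1) Sob_Obj[OF Z]] by simp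
      then have "Sar C (\<epsilon> \<cdot> g) = Sar C (Zero C A' Z)"
        using Neg_eqD[OF Sar_Hom[OF Comp_Hom[OF g(1) H(1)]]] Zero_Hom[OF A(1) Sob_Obj[OF Z]]
          Sar_Zero[OF A'(1) Z] A'(2) by simp
      then have "\<epsilon> \<cdot> g = Zero C A' Z"
        using Sar_inj Comp_Hom[OF g(1) H(1)] Zero_Hom[OF A'(1) Z] by blast
      also have "\<dots> = \<epsilon> \<cdot> Zero C A' (fob R Z)" using Comp_Zero[OF H(1) A'(1)] by simp
      finally have "g = Zero C A' (fob R Z)"
        using bij[OF A'(1) A'S] g(1) Zero_Hom[OF A'(1) RZ(1)] by (simp add: bij_betw_def inj_on_def)
      then have "d \<cdot> f = Zero C A (Sob C (fob R Z))"
        using g(2) Sar_Zero[OF A'(1) RZ(1)] A'(2) by simp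
      then obtain f' where f': "f' \<in> Hom C A Z" "f = c \<cdot> f'"
        using Tri_factor_left[OF Tri_rotateD[OF tri], unfolded dom domN, OF f] by metis
      obtain f'' where f'': "f'' \<in> Hom C A (fob R Z)" "f' = \<epsilon> \<cdot> f''"
        using bij[OF A] f'(1) by (metis bij_betw_imp_surj_on imageE)
      have "c \<cdot> (\<epsilon> \<cdot> f'') = (c \<cdot> \<epsilon>) \<cdot> f''" using Comp_assoc[OF f''(1) H(1,2)] by simp
      also have "\<dots> = Zero C A K"
        using Tri_Comp_Zero[OF tri] Zero_Comp[OF f''(1) K] by (simp add: dom)
      finally show ?thesis using f' f'' by simp
    qed
    then show ?thesis using Zero_Hom[OF A(1) K] by blast
  qed
  with tri \<epsilon> H(2) show thesis by (rule that)
qed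

text \<open>Here \<open>jl\<close>, \<open>jup\<close>, \<open>iup\<close>, \<open>il\<close>, \<open>ir\<close> stand for \<open>j\<^sub>!\<close>, \<open>j\<^sup>*\<close>, \<open>i\<^sup>*\<close>, \<open>i\<^sub>*\<close>, \<open>i\<^sup>!\<close>. A morphism \<open>Z \<rightarrow> W\<close> vanishes
  on the counit \<open>j\<^sup>* Z \<rightarrow> Z\<close>, so it factors through an object of \<open>S'\<close> and hence through \<open>i\<^sup>! W\<close>.\<close>

lemma orth_glued:
  assumes S: "\<And>A. A \<in> Obj C \<Longrightarrow> Sob C A \<in> S \<longleftrightarrow> A \<in> S"
    and S': "\<And>K. K \<in> Obj C \<Longrightarrow> (\<And>A. A \<in> Obj C \<Longrightarrow> A \<in> S \<Longrightarrow> orth C A K) \<Longrightarrow> K \<in> S'"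
    and j: "is_fctr (full_sub C S) C jl" "is_inclusion (full_sub C S) jl"
      "is_fctr C (full_sub C S) jup" "adjoint_pair (full_sub C S) C jl jup"
    and i: "is_fctr (full_sub C S') C il" "is_inclusion (full_sub C S') il"
      "is_fctr C (full_sub C S') ir" "is_fctr C (full_sub C S') iup"
      "adjoint_pair (full_sub C S') C il ir" "adjoint_pair C (full_sub C S') iup il"
    and ZW: "Z \<in> Obj C" "W \<in> Obj C"
    and orth: "orth (full_sub C S) (fob jup Z) (fob jup W)"
      "orth (full_sub C S') (fob iup Z) (fob ir W)"
  shows "orth C Z W"
proof -
  have jZ: "fob jup Z \<in> Obj (full_sub C S)" "fob jup W \<in> Obj (full_sub C S)"
    and iZ: "fob iup Z \<in> Obj (full_sub C S')" and iW: "fob ir W \<in> Obj (full_sub C S')"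
    using j(3) i(3,4) ZW by (auto simp: is_fctr_def)
  obtain \<epsilon> c d K where tri: "(\<epsilon>, c, d) \<in> Tri C" and \<epsilon>: "\<epsilon> \<in> Hom C (fob jup Z) Z"
    and c: "c \<in> Hom C Z K" and KS: "\<And>A. A \<in> Obj C \<Longrightarrow> A \<in> S \<Longrightarrow> orth C A K"
    using coreflection_triangle[OF S j(4) j(1,2,3) ZW(1)] by blast
  have K: "K \<in> Obj C" using Hom_Obj c by blast
  have K': "K \<in> Obj (full_sub C S')" using K S'[OF K KS] by simp
  have dom: "Dom C \<epsilon> = fob jup Z" "Dom C c = Z" "Dom C d = K"
    using \<epsilon> c Tri_Hom(2)[OF tri] by (auto simp: Hom_def)
  have inc: "fob jl (fob jup Z) = fob jup Z" "fob il (fob ir W) = fob ir W" "fob il K = K"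
    using j(2) i(2) jZ iW K' by (simp_all add: is_inclusion_def)
  note zero_full = Zero_Hom_full_sub[OF additive_cat_axioms]
  have orth_j: "orth C (fob jup Z) W"
    using adjoint_pair_orth[OF j(4) jZ(1) ZW(2)] orth(1) zero_full[OF jZ]
      Zero_Hom[of "fob jup Z" W] jZ ZW by (simp add: inc)
  have orth_i: "orth C Z (fob ir W)"
    using adjoint_pair_orth[OF i(6) ZW(1) iW] orth(2) zero_full[OF iZ iW]
      Zero_Hom[of Z "fob ir W"] iW ZW by (simp add: inc)
  obtain e where e0: "e \<in> Hom C (fob il (fob ir W)) W"
    and bij0: "\<And>A. A \<in> Obj (full_sub C S') \<Longrightarrow>
      bij_betw (\<lambda>g. e \<cdot> far il g) (Hom (full_sub C S') A (fob ir W)) (Hom C (fob il A) W)"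
    using adjoint_pair_counit[OF cat_full_sub[OF cat_axioms] cat_axioms i(1,3,5) ZW(2)] by blast
  note e = e0[unfolded inc(2)] and e_bij = bij0[OF K', unfolded inc(3)]
  have "f = Zero C Z W" if f: "f \<in> Hom C Z W" for f
  proof -
    have "f \<cdot> \<epsilon> = Zero C (fob jup Z) W" using Comp_Hom[OF \<epsilon> f] orth_j by simp
    then obtain h where h: "h \<in> Hom C K W" "f = h \<cdot> c"
      using Tri_factor_right[OF tri, unfolded dom, OF f] by metis
    have "h \<in> (\<lambda>g. e \<cdot> far il g) ` Hom (full_sub C S') K (fob ir W)"
      using h(1) bij_betw_imp_surj_on[OF e_bij] by simp
    then obtain h' where h': "h' \<in> Hom (full_sub C S') K (fob ir W)" "h = e \<cdot> far il h'"
      by (rule imageE) simp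
    have "far il h' = h'" using i(2) Hom_Arr[OF h'(1)] by (simp add: is_inclusion_def)
    moreover have h'C: "h' \<in> Hom C K (fob ir W)" 
      using subsetD[OF Hom_full_sub_subset h'(1)] .
    ultimately have "f = e \<cdot> (h' \<cdot> c)" using h(2) h'(2) Comp_assoc[OF c _ e] by simp
    also have "h' \<cdot> c = Zero C Z (fob ir W)" using Comp_Hom[OF c h'C] orth_i by simp
    also have "e \<cdot> Zero C Z (fob ir W) = Zero C Z W" using Comp_Zero[OF e ZW(1)] .
    finally show ?thesis .
  qed
  then show ?thesis using Zero_Hom[OF ZW] by blast
qed

end

section \<open>Comparison of the two co-t-structures\<close>

theorem theorem2p14:
  fixes U :: "'u set"
    and D Y X :: "('o, 'm) tricat"
    and \<omega> \<sigma> \<sigma>_tilde \<rho> P :: 'o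
    and \<iota> :: "'m \<Rightarrow> 'm"
    and \<alpha> :: 'm
    and iup ilow ishriek jshriek jup jlow :: "('o, 'm, 'o, 'm) fctr"
  assumes "universe U"
    and "well_generated U D"
    and "partial_silting U D \<omega>"
    and "Y = full_sub D (rperp D {\<omega>} UNIV)"
    and "X = full_sub D (Loc U D \<omega>)"
    and "recollement Y D X iup ilow ishriek jshriek jup jlow"
    and "is_inclusion Y ilow" and "is_inclusion X jshriek"
    and "dual_Brown U D" and "dual_Brown U X" and "dual_Brown U Y"
    and "silting Y \<sigma>"
    and "coproduct_closed U D
           (rperp D {fob ilow \<sigma>} {0<..} \<inter> rperp D {fob jshriek \<omega>} {0<..})"
    and "\<forall>k \<ge> 2. Hom D (fob ilow \<sigma>) (shift D k (fob jshriek \<omega>)) =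
           {Zero D (fob ilow \<sigma>) (shift D k (fob jshriek \<omega>))}"
    and "I = Hom D (fob ilow \<sigma>) (shift D 1 (fob jshriek \<omega>))"
    and "is_coproduct D I (\<lambda>_. fob ilow \<sigma>) P \<iota>"
    and "\<alpha> \<in> Hom D P (shift D 1 (fob jshriek \<omega>))"
    and "\<forall>f \<in> I. Comp D \<alpha> (\<iota> f) = f"
    and "is_cocone D \<alpha> \<sigma>_tilde"
    and "direct_sum D \<sigma>_tilde (fob ilow \<sigma>) \<rho>"
  shows "silting_cotstr D \<rho> =
           glued D iup ishriek jup (silting_cotstr Y \<sigma>) (silting_cotstr X \<omega>)"
proof -
  interpret triangulated_cat D using assms(2) by (simp add: well_generated_def)
  let ?S = "Loc U D \<omega>" and ?S' = "rperp D {\<omega>} UNIV"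
  note Y = assms(4) and X = assms(5)
  note rec = assms(6)[unfolded recollement_def X Y]
  have tri: "triangle_fctr D (full_sub D ?S') iup" "triangle_fctr (full_sub D ?S') D ilow"
      "triangle_fctr D (full_sub D ?S') ishriek" "triangle_fctr (full_sub D ?S) D jshriek"
      "triangle_fctr D (full_sub D ?S) jup" "triangle_fctr (full_sub D ?S) D jlow"
    and adj: "adjoint_pair D (full_sub D ?S') iup ilow"
      "adjoint_pair (full_sub D ?S') D ilow ishriek"
      "adjoint_pair (full_sub D ?S) D jshriek jup" "adjoint_pair D (full_sub D ?S) jup jlow"
    and ff: "fully_faithful (full_sub D ?S) D jlow"
    and zero: "\<And>A. A \<in> Obj (full_sub D ?S) \<Longrightarrow>
      is_zero (full_sub D ?S') (fob ishriek (fob jlow A))"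
    using rec by blast+
  note fctr = tri[unfolded triangle_fctr_def, THEN conjunct1]
  note inc = assms(7)[unfolded Y] assms(8)[unfolded X]
  have \<omega>: "\<omega> \<in> Obj D" "\<omega> \<in> ?S"
    using assms(3) by (auto simp: partial_silting_def rperp_def Loc_def)
  have \<sigma>: "\<sigma> \<in> Obj D" "\<sigma> \<in> ?S'"
    using assms(12) by (auto simp: silting_def Y)
  have inc_ob: "fob ilow \<sigma> = \<sigma>" "fob jshriek \<omega> = \<omega>"
    using inc \<omega> \<sigma> by (auto simp: is_inclusion_def)
  \<comment> \<open>Both subcategories are closed under \<open>[1]\<close> and \<open>[-1]\<close>.\<close>
  note stableX = Sob_Loc_iff[where U = U and T = \<omega>]
  note stableY = rperp_Sob_iff[where \<C> = "{\<omega>}"]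
  let ?Y'' = "rperp Y {\<sigma>} {0..}" and ?X'' = "rperp X {\<omega>} {0..}"
  let ?D'' = "rperp D {\<sigma>} {0..} \<inter> rperp D {\<omega>} {0..}"
  have D''_rho: "rperp D {\<rho>} {0..} = ?D''"
    using rperp_cocone_direct_sum assms(16,17,19,20) \<omega>(1) unfolding inc_ob by blast
  have ishriek: "fob ishriek Z \<in> ?Y'' \<longleftrightarrow> Z \<in> rperp D {\<sigma>} {0..}" if "Z \<in> Obj D" for Z
    using rperp_coreflection_iff[OF stableY adj(2) inc(1) tri(3) \<sigma> that] by (simp add: Y)
  have jup: "fob jup Z \<in> ?X'' \<longleftrightarrow> Z \<in> rperp D {\<omega>} {0..}" if "Z \<in> Obj D" for Z
    using rperp_coreflection_iff[OF stableX adj(3) inc(2) tri(5) \<omega> that] by (simp add: X)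
  have D''_sub: "?D'' \<subseteq> Obj D" by (auto simp: rperp_def)
  \<comment> \<open>An object that receives nothing from \<open>Loc(\<omega>)\<close> is orthogonal to \<open>\<omega>\<close> in all degrees.\<close>
  have cone: "K \<in> ?S'" if K: "K \<in> Obj D" "\<And>A. A \<in> Obj D \<Longrightarrow> A \<in> ?S \<Longrightarrow> orth D A K" for K
  proof -
    have "orth D \<omega> (shift D n K)" for n
      using orth_shift[OF \<omega>(1) K(1)] K(2) shift_Obj[OF \<omega>(1)] shift_mem_iff[OF stableX \<omega>(1)] \<omega>(2)
      by blast
    then show ?thesis using K(1) by (simp add: rperp_def)
  qed
  have D': "Z \<in> lperp D ?D'' {0} \<longleftrightarrow>
      fob iup Z \<in> lperp Y ?Y'' {0} \<and> fob jup Z \<in> lperp X ?X'' {0}" if Z: "Z \<in> Obj D" for Z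
  proof -
    have iZ: "fob iup Z \<in> Obj (full_sub D ?S')" and jZ: "fob jup Z \<in> Obj (full_sub D ?S)"
      using fctr(1,5) Z by (auto simp: is_fctr_def)
    note zero_full = Zero_Hom_full_sub[OF additive_cat_axioms]
    show ?thesis
    proof
      assume *: "fob iup Z \<in> lperp Y ?Y'' {0} \<and> fob jup Z \<in> lperp X ?X'' {0}"
      have "orth D Z W" if W: "W \<in> ?D''" for W
      proof (rule orth_glued[OF stableX cone fctr(4) inc(2) fctr(5) adj(3) fctr(2) inc(1)
            fctr(3,1) adj(2,1) Z])
        show W': "W \<in> Obj D" using W D''_sub by blast
        show "orth (full_sub D ?S) (fob jup Z) (fob jup W)"
          using * jup[OF W'] W by (simp add: lperp_0 X)
        show "orth (full_sub D ?S') (fob iup Z) (fob ishriek W)"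
          using * ishriek[OF W'] W by (simp add: lperp_0 Y)
      qed
      then show "Z \<in> lperp D ?D'' {0}" using Z by (simp add: lperp_0)
    next
      assume *: "Z \<in> lperp D ?D'' {0}"
      have "orth Y (fob iup Z) B" if B: "B \<in> ?Y''" for B
      proof -
        have BY: "B \<in> ?S'" "B \<in> rperp D {\<sigma>} {0..}"
          using B rperp_full_sub_iff[OF stableY \<sigma>(2)] by (auto simp: Y)
        then have BO: "B \<in> Obj D" and "B \<in> rperp D {\<omega>} {0..}" by (auto simp: rperp_def)
        then have "orth D Z B" using * BY by (simp add: lperp_0)
        moreover have "fob ilow B = B" using inc(1) BY BO by (simp add: is_inclusion_def)
        ultimately show ?thesis
          using adjoint_pair_orth[OF adj(1) Z, of B] zero_full[OF iZ, of B] Zero_Hom[OF Z BO] BY BO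
          by (simp add: Y)
      qed
      moreover have "orth X (fob jup Z) B" if B: "B \<in> ?X''" for B
      proof -
        have BX: "B \<in> ?S" "B \<in> rperp D {\<omega>} {0..}"
          using B rperp_full_sub_iff[OF stableX \<omega>(2)] by (auto simp: X)
        have BO: "B \<in> Obj (full_sub D ?S)" using BX by (simp add: rperp_def)
        have jB: "fob jlow B \<in> Obj D" using fctr(6) BO by (simp add: is_fctr_def)
        have "fob ishriek (fob jlow B) \<in> ?Y''"
        proof -
          have "is_zero D (fob ishriek (fob jlow B))" "fob ishriek (fob jlow B) \<in> ?S'"
            using zero[OF BO] by (auto simp: is_zero_def)
          then show ?thesis
            using rperp_is_zero[OF _ \<sigma>(1)] rperp_full_sub_iff[OF stableY \<sigma>(2)] by (simp add: Y)
        qed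
        \<comment> \<open>\<open>j\<^sup>* j\<^sub>* B\<close> is a retract of \<open>B\<close>, which suffices here.\<close>
        moreover have "fob jup (fob jlow B) \<in> ?X''"
        proof -
          obtain e s where e: "e \<in> Hom (full_sub D ?S) (fob jup (fob jlow B)) B"
            and s: "s \<in> Hom (full_sub D ?S) B (fob jup (fob jlow B))"
            and se: "Comp (full_sub D ?S) s e = Ident (full_sub D ?S) (fob jup (fob jlow B))"
            using fully_faithful_right_adjoint_split[OF cat_axioms cat_full_sub[OF cat_axioms]
                fctr(5,6) adj(4) ff BO] by blast
          have "fob jup (fob jlow B) \<in> rperp D {\<omega>} {0..}"
            using rperp_retract[OF BX(2) _ _ _ \<omega>(1)] e s se Hom_full_sub_subset by fastforce
          moreover have "fob jup (fob jlow B) \<in> ?S" using fctr(5) jB by (simp add: is_fctr_def)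
          ultimately show ?thesis using rperp_full_sub_iff[OF stableX \<omega>(2)] by (simp add: X)
        qed
        ultimately have "orth D Z (fob jlow B)"
          using * ishriek[OF jB] jup[OF jB] by (simp add: lperp_0)
        then show ?thesis
          using adjoint_pair_orth[OF adj(4) Z BO] zero_full[OF jZ BO] Zero_Hom[OF Z jB]
          by (simp add: X)
      qed
      ultimately show "fob iup Z \<in> lperp Y ?Y'' {0} \<and> fob jup Z \<in> lperp X ?X'' {0}"
        using iZ jZ by (simp add: lperp_0 X Y)
    qed
  qed
  have "lperp D ?D'' {0} \<subseteq> Obj D" by (auto simp: lperp_def)
  then show ?thesis
    using D' ishriek jup D''_sub by (auto simp: silting_cotstr_def glued_def D''_rho)
qed

end
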